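(* Let $\varphi:M\to N$ be a diffeomorphism between $3$-dimensional oriented Riemannian manifolds $(M,g)$, $(N,h)$. Suppose $S=(\varphi_\ast)^*\varphi_\ast$ has distinct eigenvalues $\lambda_1<\lambda_2<\lambda_3$, and write $\lambda=\lambda_2$. Let $U\subset M$ be open, let $\xi_2$ be a smooth unit eigenvector field of $S$ on $U$ corresponding to $\lambda_2$, and let $\eta_2=g(\xi_2,\cdot)$ be the $1$-form dual to $\xi_2$. Let $e_1,e_2,e_3$ be a smooth positively oriented orthonormal frame on $U$ with dual $1$-forms $\omega_1,\omega_2,\omega_3$, and let $a_{ij},\beta_i,a_{ij}^k,\mu_k,\beta_{ik},\gamma_k,C^i_{jk}$ be as defined in the context. If $\varphi$ is leafwise conformal on $U$, then there is a smooth function $\mu$ on $U$, equal at every point to $\sqrt{\lambda_2-\lambda_1}\sqrt{\lambda_3-\lambda_2}$ or to $-\sqrt{\lambda_2-\lambda_1}\sqrt{\lambda_3-\lambda_2}$, such that, with $$U_1=\{x\in U:(a_{23}-\mu\beta_1)^2+(a_{13}+\mu\beta_2)^2>0\},$$ $$U_2=\{x\in U:(a_{23}+\mu\beta_1)^2+(a_{12}-\mu\beta_3)^2>0\},$$ $$U_3=\{x\in U:(a_{12}+\mu\beta_3)^2+(a_{13}-\mu\beta_2)^2>0\},$$ the following three conditions hold. (i) On $U_1$: $$\begin{aligned}0={}&\big(-a^2_{13}+a^1_{23}-\beta_1\mu_1-\beta_2\mu_2-\mu\beta_{11}-\mu\beta_{22}-(a_{13}+\mu\beta_2)C^1_{12}-(a_{23}-\mu\beta_1)C^2_{12}-(a_{33}-\lambda)C^3_{12}\big)(a_{33}-\lambda)\\&-\big(-a^3_{13}+a^1_{33}-\beta_2\mu_3-\mu\beta_{23}-\gamma_1-(a_{13}+\mu\beta_2)C^1_{13}-(a_{23}-\mu\beta_1)C^2_{13}-(a_{33}-\lambda)C^3_{13}\big)(a_{23}-\mu\beta_1)\\&+\big(-a^3_{23}+a^2_{33}+\beta_1\mu_3+\mu\beta_{13}-\gamma_2-(a_{13}+\mu\beta_2)C^1_{23}-(a_{23}-\mu\beta_1)C^2_{23}-(a_{33}-\lambda)C^3_{23}\big)(a_{13}+\mu\beta_2).\end{aligned}$$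 (ii) On $U_2$: $$\begin{aligned}0={}&\big(-a^2_{12}+a^1_{22}+\beta_3\mu_2+\mu\beta_{32}-\gamma_1-(a_{12}-\mu\beta_3)C^1_{12}-(a_{22}-\lambda)C^2_{12}-(a_{23}+\mu\beta_1)C^3_{12}\big)(a_{23}+\mu\beta_1)\\&-\big(-a^3_{12}+a^1_{23}+\beta_3\mu_3+\beta_1\mu_1+\mu\beta_{33}+\mu\beta_{11}-(a_{12}-\mu\beta_3)C^1_{13}-(a_{22}-\lambda)C^2_{13}-(a_{23}+\mu\beta_1)C^3_{13}\big)(a_{22}-\lambda)\\&+\big(-a^3_{22}+a^2_{23}+\beta_1\mu_2+\mu\beta_{12}+\gamma_3-(a_{12}-\mu\beta_3)C^1_{23}-(a_{22}-\lambda)C^2_{23}-(a_{23}+\mu\beta_1)C^3_{23}\big)(a_{12}-\mu\beta_3).\end{aligned}$$ (iii) On $U_3$: $$\begin{aligned}0={}&\big(-a^2_{11}+a^1_{12}+\beta_3\mu_1+\mu\beta_{31}+\gamma_2-(a_{11}-\lambda)C^1_{12}-(a_{12}+\mu\beta_3)C^2_{12}-(a_{13}-\mu\beta_2)C^3_{12}\big)(a_{13}-\mu\beta_2)\\&-\big(-a^3_{11}+a^1_{13}-\beta_2\mu_1-\mu\beta_{21}+\gamma_3-(a_{11}-\lambda)C^1_{13}-(a_{12}+\mu\beta_3)C^2_{13}-(a_{13}-\mu\beta_2)C^3_{13}\big)(a_{12}+\mu\beta_3)\\&+\big(-a^3_{12}+a^2_{13}-\beta_2\mu_2-\beta_3\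mu_3-\mu\beta_{22}-\mu\beta_{33}-(a_{11}-\lambda)C^1_{23}-(a_{12}+\mu\beta_3)C^2_{23}-(a_{13}-\mu\beta_2)C^3_{23}\big)(a_{11}-\lambda).\end{aligned}$$
   Context: For $x\in M$, $(\varphi_{\ast x})^*$ is the adjoint of $\varphi_{\ast x}:T_xM\to T_{\varphi(x)}N$ with respect to $g,h$, and $S_x=(\varphi_{\ast x})^*\varphi_{\ast x}$ is self-adjoint and positive definite on $T_xM$. It also acts on $T_x^*M$ by $(S_x\eta)X=\eta(S_xX)$. The map $\varphi$ is leafwise conformal on an open set $U\subset M$ if there is a $2$-dimensional foliation $\mathcal F$ of $U$ such that $\varphi:L\to\varphi(L)$ is conformal (for the induced metrics) for every leaf $L\in\mathcal F$. Notation relative to the frame $e_1,e_2,e_3$ and dual coframe $\omega_1,\omega_2,\omega_3$ (superscripts are indices, not powers, in the symbols $a_{ij}^k$ and $C^i_{jk}$): $S\omega_i=\sum_j a_{ij}\omega_j$ (so $a_{ij}=a_{ji}$), $\eta_2=\sum_i\beta_i\omega_i$, $da_{ij}=\sum_k a^k_{ij}\omega_k$, $d\mu=\sum_k\mu_k\omega_k$, $d\beta_i=\sum_k\beta_{ik}\omega_k$, $d\lambda=\sum_k\gamma_k\omega_k$, and $[e_j,e_k]=\sum_i C^i_{jk}e_i$. *)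

theory Defs
  imports "HOL-Analysis.Analysis"
begin

section \<open>Smooth functions between Euclidean spaces\<close>

text \<open>Both notions are meant for an open set \<open>U\<close>.\<close>

primrec Ck_on :: "nat \<Rightarrow> 'a::euclidean_space set \<Rightarrow> ('a \<Rightarrow> 'b::real_normed_vector) \<Rightarrow> bool" where
  "Ck_on 0 U f \<longleftrightarrow> continuous_on U f"
| "Ck_on (Suc k) U f \<longleftrightarrow> (\<forall>x\<in>U. f differentiable (at x)) \<and>
     (\<forall>v. Ck_on k U (\<lambda>x. frechet_derivative f (at x) v))"

definition smooth_on :: "'a::euclidean_space set \<Rightarrow> ('a \<Rightarrow> 'b::real_normed_vector) \<Rightarrow> bool" where
  "smooth_on U f \<longleftrightarrow> (\<forall>k. Ck_on k U f)"


section \<open>Smooth manifolds\<close>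

text \<open>
  A chart is a pair of a domain and a coordinate map; the values of the coordinate map outside
  the domain are irrelevant. The smooth structure is a maximal atlas.
\<close>

type_synonym ('a, 'n) chart = "'a set \<times> ('a \<Rightarrow> real ^ 'n)"

record ('a, 'n) manifold =
  mtop :: "'a topology"
  matlas :: "('a, 'n) chart set"

abbreviation mpoints :: "('a, 'n, 'm) manifold_scheme \<Rightarrow> 'a set" where
  "mpoints M \<equiv> topspace (mtop M)"

definition cinv :: "('a, 'n) chart \<Rightarrow> real ^ 'n \<Rightarrow> 'a" where
  "cinv c = inv_into (fst c) (snd c)"

definition transition :: "('a, 'n) chart \<Rightarrow> ('a, 'n) chart \<Rightarrow> real ^ 'n \<Rightarrow> real ^ 'n" where
  "transition c d = snd d \<circ> cinv c"

definition topological_chart :: "'a topology \<Rightarrow> ('a, 'n::finite) chart \<Rightarrow> bool" where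
  "topological_chart T c \<longleftrightarrow> openin T (fst c) \<and> open (snd c ` fst c) \<and>
     homeomorphic_map (subtopology T (fst c)) (top_of_set (snd c ` fst c)) (snd c)"

definition smoothly_compatible :: "('a, 'n::finite) chart \<Rightarrow> ('a, 'n) chart \<Rightarrow> bool" where
  "smoothly_compatible c d \<longleftrightarrow>
     smooth_on (snd c ` (fst c \<inter> fst d)) (transition c d) \<and>
     smooth_on (snd d ` (fst c \<inter> fst d)) (transition d c)"

definition smooth_manifold :: "('a, 'n::finite, 'm) manifold_scheme \<Rightarrow> bool" where
  "smooth_manifold M \<longleftrightarrow>
     Hausdorff_space (mtop M) \<and> second_countable (mtop M) \<and>
     (\<forall>c\<in>matlas M. topological_chart (mtop M) c) \<and>
     (\<Union>c\<in>matlas M. fst c) = mpoints M \<and>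
     (\<forall>c\<in>matlas M. \<forall>d\<in>matlas M. smoothly_compatible c d) \<and>
     (\<forall>c. topological_chart (mtop M) c \<and> (\<forall>d\<in>matlas M. smoothly_compatible c d)
            \<longrightarrow> c \<in> matlas M)"

definition charts_at :: "('a, 'n, 'm) manifold_scheme \<Rightarrow> 'a \<Rightarrow> ('a, 'n) chart set" where
  "charts_at M x = {c \<in> matlas M. x \<in> fst c}"

definition smooth_fun_on ::
  "('a, 'n::finite, 'm) manifold_scheme \<Rightarrow> 'a set \<Rightarrow> ('a \<Rightarrow> 'b::real_normed_vector) \<Rightarrow> bool" where
  "smooth_fun_on M U f \<longleftrightarrow> (\<forall>c\<in>matlas M. smooth_on (snd c ` (fst c \<inter> U)) (f \<circ> cinv c))"

definition smooth_map ::
  "('a, 'n::finite, 'm) manifold_scheme \<Rightarrow> ('b, 'k::finite, 'l) manifold_scheme \<Rightarrow> ('a \<Rightarrow> 'b) \<Rightarrow> bool" where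
  "smooth_map M N f \<longleftrightarrow> continuous_map (mtop M) (mtop N) f \<and>
     (\<forall>c\<in>matlas M. \<forall>d\<in>matlas N.
        smooth_on (snd c ` {x \<in> fst c. f x \<in> fst d}) (snd d \<circ> f \<circ> cinv c))"

definition diffeomorphism ::
  "('a, 'n::finite, 'm) manifold_scheme \<Rightarrow> ('b, 'k::finite, 'l) manifold_scheme \<Rightarrow> ('a \<Rightarrow> 'b) \<Rightarrow> bool" where
  "diffeomorphism M N f \<longleftrightarrow> bij_betw f (mpoints M) (mpoints N) \<and>
     smooth_map M N f \<and> smooth_map N M (inv_into (mpoints M) f)"


section \<open>Tangent vectors\<close>

text \<open>
  A tangent vector at \<open>x\<close> is the family of its component vectors in all charts around \<open>x\<close>,
  which transform by the derivatives of the transition maps. The value \<open>0\<close> at all other charts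
  is a normalisation that makes equality of tangent vectors equality of families. Vector space
  operations are pointwise.
\<close>

type_synonym ('a, 'n) tangent = "('a, 'n) chart \<Rightarrow> real ^ 'n"

type_synonym ('a, 'n) vfield = "'a \<Rightarrow> ('a, 'n) tangent"

definition tangent_space ::
  "('a, 'n::finite, 'm) manifold_scheme \<Rightarrow> 'a \<Rightarrow> ('a, 'n) tangent set" where
  "tangent_space M x = {v.
     (\<forall>c\<in>charts_at M x. \<forall>d\<in>charts_at M x.
        v d = frechet_derivative (transition c d) (at (snd c x)) (v c)) \<and>
     (\<forall>c. c \<notin> charts_at M x \<longrightarrow> v c = 0)}"

text \<open>The tangent vector with components \<open>u\<close> in the chart \<open>c\<close>.\<close>

definition tangent_of ::
  "('a, 'n::finite, 'm) manifold_scheme \<Rightarrow> ('a, 'n) chart \<Rightarrow> 'a \<Rightarrow> real ^ 'n \<Rightarrow> ('a, 'n) tangent" where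
  "tangent_of M c x u = (\<lambda>d. if d \<in> charts_at M x
     then frechet_derivative (transition c d) (at (snd c x)) u else 0)"

text \<open>
  The differential \<open>df\<^sub>x(v)\<close> of a vector valued function, computed in an arbitrary chart
  around \<open>x\<close>; for differentiable \<open>f\<close> and tangent \<open>v\<close> the choice of chart is immaterial.
\<close>

definition differential ::
  "('a, 'n::finite, 'm) manifold_scheme \<Rightarrow> ('a \<Rightarrow> 'b::real_normed_vector) \<Rightarrow> 'a
     \<Rightarrow> ('a, 'n) tangent \<Rightarrow> 'b" where
  "differential M f x v = (let c = (SOME c. c \<in> charts_at M x)
     in frechet_derivative (f \<circ> cinv c) (at (snd c x)) (v c))"

definition pushforward ::
  "('a, 'n::finite, 'm) manifold_scheme \<Rightarrow> ('b, 'k::finite, 'l) manifold_scheme \<Rightarrow> ('a \<Rightarrow> 'b)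
     \<Rightarrow> 'a \<Rightarrow> ('a, 'n) tangent \<Rightarrow> ('b, 'k) tangent" where
  "pushforward M N f x v = (\<lambda>d. if d \<in> charts_at N (f x)
     then differential M (snd d \<circ> f) x v else 0)"

definition covector ::
  "('a, 'n::finite, 'm) manifold_scheme \<Rightarrow> 'a \<Rightarrow> (('a, 'n) tangent \<Rightarrow> real) \<Rightarrow> bool" where
  "covector M x \<alpha> \<longleftrightarrow> (\<forall>v\<in>tangent_space M x. \<forall>w\<in>tangent_space M x. \<forall>s t.
     \<alpha> (\<lambda>c. s *\<^sub>R v c + t *\<^sub>R w c) = s * \<alpha> v + t * \<alpha> w)"

definition smooth_vfield_on ::
  "('a, 'n::finite, 'm) manifold_scheme \<Rightarrow> 'a set \<Rightarrow> ('a, 'n) vfield \<Rightarrow> bool" where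
  "smooth_vfield_on M U X \<longleftrightarrow> (\<forall>x\<in>U. X x \<in> tangent_space M x) \<and>
     (\<forall>c\<in>matlas M. smooth_on (snd c ` (fst c \<inter> U)) (\<lambda>p. X (cinv c p) c))"

text \<open>
  In coordinates \<open>[X, Y]\<^sup>i = X\<^sup>j \<partial>\<^sub>j Y\<^sup>i - Y\<^sup>j \<partial>\<^sub>j X\<^sup>i\<close>, i.e. \<open>[X, Y] f = X (Y f) - Y (X f)\<close>.
\<close>

definition lie_bracket ::
  "('a, 'n::finite, 'm) manifold_scheme \<Rightarrow> ('a, 'n) vfield \<Rightarrow> ('a, 'n) vfield \<Rightarrow> ('a, 'n) vfield" where
  "lie_bracket M X Y x = (\<lambda>c. if c \<in> charts_at M x
     then frechet_derivative (\<lambda>p. Y (cinv c p) c) (at (snd c x)) (X x c)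
        - frechet_derivative (\<lambda>p. X (cinv c p) c) (at (snd c x)) (Y x c)
     else 0)"


section \<open>Oriented Riemannian manifolds\<close>

text \<open>An orientation is given by a covering set of charts that are declared positive.\<close>

record ('a, 'n) oriented_riemannian = "('a, 'n) manifold" +
  pos_charts :: "('a, 'n) chart set"
  metric :: "'a \<Rightarrow> ('a, 'n) tangent \<Rightarrow> ('a, 'n) tangent \<Rightarrow> real"

definition orientation :: "('a, 'n::finite, 'm) manifold_scheme \<Rightarrow> ('a, 'n) chart set \<Rightarrow> bool" where
  "orientation M P \<longleftrightarrow> P \<subseteq> matlas M \<and> (\<Union>c\<in>P. fst c) = mpoints M \<and>
     (\<forall>c\<in>P. \<forall>d\<in>P. \<forall>x\<in>fst c \<inter> fst d.
        det (matrix (frechet_derivative (transition c d) (at (snd c x)))) > 0)"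

definition riemannian_metric ::
  "('a, 'n::finite, 'm) manifold_scheme
     \<Rightarrow> ('a \<Rightarrow> ('a, 'n) tangent \<Rightarrow> ('a, 'n) tangent \<Rightarrow> real) \<Rightarrow> bool" where
  "riemannian_metric M g \<longleftrightarrow>
     (\<forall>x\<in>mpoints M. \<forall>v\<in>tangent_space M x. covector M x (g x v) \<and>
        (\<forall>w\<in>tangent_space M x. g x v w = g x w v) \<and>
        (v \<noteq> (\<lambda>_. 0) \<longrightarrow> g x v v > 0)) \<and>
     (\<forall>c\<in>matlas M. \<forall>u w. smooth_on (snd c ` fst c)
        (\<lambda>p. g (cinv c p) (tangent_of M c (cinv c p) u) (tangent_of M c (cinv c p) w)))"

definition oriented_riemannian_manifold ::
  "('a, 'n::finite, 'm) oriented_riemannian_scheme \<Rightarrow> bool" where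
  "oriented_riemannian_manifold M \<longleftrightarrow>
     smooth_manifold M \<and> orientation M (pos_charts M) \<and> riemannian_metric M (metric M)"

definition pos_orthonormal_frame_on ::
  "('a, 'n::finite, 'm) oriented_riemannian_scheme \<Rightarrow> 'a set \<Rightarrow> ('n \<Rightarrow> ('a, 'n) vfield) \<Rightarrow> bool" where
  "pos_orthonormal_frame_on M U e \<longleftrightarrow>
     (\<forall>i. smooth_vfield_on M U (e i)) \<and>
     (\<forall>x\<in>U. \<forall>i j. metric M x (e i x) (e j x) = (if i = j then 1 else 0)) \<and>
     (\<forall>x\<in>U. \<forall>c\<in>pos_charts M. x \<in> fst c \<longrightarrow> det (\<chi> i. e i x c) > 0)"

definition dual_coframe_on ::
  "('a, 'n::finite, 'm) manifold_scheme \<Rightarrow> 'a set \<Rightarrow> ('n \<Rightarrow> ('a, 'n) vfield)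
     \<Rightarrow> ('n \<Rightarrow> 'a \<Rightarrow> ('a, 'n) tangent \<Rightarrow> real) \<Rightarrow> bool" where
  "dual_coframe_on M U e \<omega> \<longleftrightarrow>
     (\<forall>x\<in>U. \<forall>i. covector M x (\<omega> i x) \<and> (\<forall>j. \<omega> i x (e j x) = (if i = j then 1 else 0)))"


section \<open>The endomorphism \<open>S\<close>\<close>

definition pushforward_adjoint ::
  "('a, 'n::finite, 'm) oriented_riemannian_scheme \<Rightarrow> ('b, 'k::finite, 'l) oriented_riemannian_scheme
     \<Rightarrow> ('a \<Rightarrow> 'b) \<Rightarrow> 'a \<Rightarrow> ('b, 'k) tangent \<Rightarrow> ('a, 'n) tangent" where
  "pushforward_adjoint M N f x w = (THE v. v \<in> tangent_space M x \<and>
     (\<forall>u\<in>tangent_space M x. metric M x v u = metric N (f x) w (pushforward M N f x u)))"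

definition S_endo ::
  "('a, 'n::finite, 'm) oriented_riemannian_scheme \<Rightarrow> ('b, 'k::finite, 'l) oriented_riemannian_scheme
     \<Rightarrow> ('a \<Rightarrow> 'b) \<Rightarrow> 'a \<Rightarrow> ('a, 'n) tangent \<Rightarrow> ('a, 'n) tangent" where
  "S_endo M N f x v = pushforward_adjoint M N f x (pushforward M N f x v)"

definition eigenvector_at ::
  "('a, 'n::finite, 'm) manifold_scheme \<Rightarrow> 'a \<Rightarrow> (('a, 'n) tangent \<Rightarrow> ('a, 'n) tangent)
     \<Rightarrow> real \<Rightarrow> ('a, 'n) tangent \<Rightarrow> bool" where
  "eigenvector_at M x A t v \<longleftrightarrow>
     v \<in> tangent_space M x \<and> v \<noteq> (\<lambda>_. 0) \<and> A v = (\<lambda>c. t *\<^sub>R v c)"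

definition eigenvalues_at ::
  "('a, 'n::finite, 'm) manifold_scheme \<Rightarrow> 'a \<Rightarrow> (('a, 'n) tangent \<Rightarrow> ('a, 'n) tangent)
     \<Rightarrow> real set" where
  "eigenvalues_at M x A = {t. \<exists>v. eigenvector_at M x A t v}"


section \<open>Two-dimensional foliations and leafwise conformality\<close>

text \<open>
  A foliation of codimension one is given by an atlas of foliated charts. Their images are boxes,
  so that the plaques (the level sets of the third coordinate) are connected surfaces; on
  overlaps the partitions into plaques agree locally.
\<close>

definition foliated_atlas ::
  "('a, 3, 'm) manifold_scheme \<Rightarrow> 'a set \<Rightarrow> ('a, 3) chart set \<Rightarrow> bool" where
  "foliated_atlas M U F \<longleftrightarrow>
     F \<subseteq> matlas M \<and> (\<Union>c\<in>F. fst c) = U \<and>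
     (\<forall>c\<in>F. \<exists>a b. snd c ` fst c = box a b) \<and>
     (\<forall>c\<in>F. \<forall>d\<in>F. \<forall>x\<in>fst c \<inter> fst d. \<exists>W. openin (mtop M) W \<and> x \<in> W \<and> W \<subseteq> fst c \<inter> fst d \<and>
        (\<forall>p\<in>W. \<forall>q\<in>W. snd c p $ 3 = snd c q $ 3 \<longleftrightarrow> snd d p $ 3 = snd d q $ 3))"

definition same_plaque :: "('a, 3) chart set \<Rightarrow> ('a \<times> 'a) set" where
  "same_plaque F = {(x, y). \<exists>c\<in>F. x \<in> fst c \<and> y \<in> fst c \<and> snd c x $ 3 = snd c y $ 3}"

text \<open>Two points lie on the same leaf if they are joined by a finite chain of plaques.\<close>

definition leaves :: "'a set \<Rightarrow> ('a, 3) chart set \<Rightarrow> 'a set set" where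
  "leaves U F = {{y. (x, y) \<in> (same_plaque F)\<^sup>*} | x. x \<in> U}"

text \<open>The tangent space at \<open>x\<close> of the leaf through \<open>x\<close>, i.e. of any plaque containing \<open>x\<close>.\<close>

definition leaf_tangent_space ::
  "('a, 3, 'm) manifold_scheme \<Rightarrow> ('a, 3) chart set \<Rightarrow> 'a \<Rightarrow> ('a, 3) tangent set" where
  "leaf_tangent_space M F x =
     {v \<in> tangent_space M x. \<forall>c\<in>F. x \<in> fst c \<longrightarrow> v c $ 3 = 0}"

text \<open>
  Conformality of \<open>\<phi> : L \<rightarrow> \<phi>(L)\<close> for the induced metrics. The conformal factor \<open>\<rho>\<close> is a
  quotient of smooth functions along \<open>L\<close>, hence automatically smooth.
\<close>

definition conformal_on_leaf ::
  "('a, 3, 'm) oriented_riemannian_scheme \<Rightarrow> ('b, 3, 'l) oriented_riemannian_scheme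
     \<Rightarrow> ('a \<Rightarrow> 'b) \<Rightarrow> ('a, 3) chart set \<Rightarrow> 'a set \<Rightarrow> bool" where
  "conformal_on_leaf M N f F L \<longleftrightarrow> (\<exists>\<rho>. \<forall>x\<in>L. \<rho> x > 0 \<and>
     (\<forall>v\<in>leaf_tangent_space M F x. \<forall>w\<in>leaf_tangent_space M F x.
        metric N (f x) (pushforward M N f x v) (pushforward M N f x w) = \<rho> x * metric M x v w))"

definition leafwise_conformal ::
  "('a, 3, 'm) oriented_riemannian_scheme \<Rightarrow> ('b, 3, 'l) oriented_riemannian_scheme
     \<Rightarrow> ('a \<Rightarrow> 'b) \<Rightarrow> 'a set \<Rightarrow> bool" where
  "leafwise_conformal M N f U \<longleftrightarrow>
     (\<exists>F. foliated_atlas M U F \<and> (\<forall>L\<in>leaves U F. conformal_on_leaf M N f F L))"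

end

theory Submission
  imports Defs
begin

text \<open>
  On a leaf the quadratic form of \<open>S\<close> is a multiple of the metric. A plane with this property
  must have factor \<open>\<lambda>\<^sub>2\<close>, and if \<open>n\<close> is a conormal of the plane, then
  \<open>S - \<lambda>\<^sub>2\<close> is the symmetrised product of \<open>n\<close> with a second covector \<open>m\<close>. The antisymmetric
  part of \<open>m \<otimes> n\<close> is \<open>\<mu>\<close> times the Hodge dual of \<open>\<eta>\<^sub>2\<close>, with \<open>\<mu>\<^sup>2 = (\<lambda>\<^sub>2 - \<lambda>\<^sub>1)(\<lambda>\<^sub>3 - \<lambda>\<^sub>2)\<close>.
  Hence the rows of \<open>S - \<lambda>\<^sub>2 + \<mu> *\<eta>\<^sub>2\<close> are multiples of \<open>n\<close>, and the three identities are the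
  Frobenius conditions \<open>\<theta> \<and> d\<theta> = 0\<close> for these rows. Taking for \<open>n\<close> the differential of the
  transversal coordinate of a foliated chart makes \<open>\<mu>\<close> a rational function of smooth functions, which
  fixes the sign of \<open>\<mu>\<close> smoothly, and makes the Frobenius conditions a consequence of \<open>dn = 0\<close>.
\<close>

section \<open>Smooth functions\<close>

text \<open>A symmetric form with three distinct eigenvalues is a multiple of the metric on exactly
  two planes, both containing the middle eigenvector; their conormals are \<open>m\<close> and
  \<open>n\<close>. Exchanging the two reverses the cross product of \<open>m\<close> and
  \<open>n\<close>, so the sign of \<open>\<mu>\<close> records which of the two planes is tangent
  to the leaf. A pointwise choice of square root could jump between them; the foliation prevents
  this. A foliated chart fixes \<open>n\<close> only up to a factor that changes with the chart,
  which is why \<open>\<mu>\<close> is given by a formula homogeneous of degree zero in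
  \<open>n\<close>: the functions found in different charts then agree on overlaps, and no global
  conormal is needed. Differentiating the rows also requires that \<open>a i j\<close>,
  \<open>\<beta> i\<close> and \<open>lam2\<close> are smooth, which is not among the hypotheses. It
  is recovered from the identities a_ij = h(\<phi>_* e_j, \<phi>_* e_i), \<beta>_i = g(\<xi>_2, e_i)
  and \<lambda>_2 = sum of \<beta>_i a_ij \<beta>_j.\<close>

lemma Ck_on_subset: "V \<subseteq> U \<Longrightarrow> Ck_on k U f \<Longrightarrow> Ck_on k V f"
  by (induction k arbitrary: f) (auto intro: continuous_on_subset)

lemma Ck_on_Suc_imp: "Ck_on (Suc k) U f \<Longrightarrow> Ck_on k U f"
proof (induction k arbitrary: f)
  case 0
  then show ?case
    by (auto intro!: continuous_at_imp_continuous_on differentiable_imp_continuous_within)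
qed auto

lemma has_derivative_cong_eventually:
  assumes "eventually (\<lambda>y. f y = g y) (nhds x)"
  shows "(f has_derivative D) (at x) \<longleftrightarrow> (g has_derivative D) (at x)"
proof -
  have fg: "f x = g x" using assms eventually_nhds_x_imp_x by blast
  have "eventually (\<lambda>y. f y = g y) (at x)"
    using assms by (simp add: eventually_at_filter eventually_mono)
  moreover then have "eventually (\<lambda>y. g y = f y) (at x)"
    by (simp add: eq_commute)
  ultimately show ?thesis
    using fg has_derivative_transform_eventually[of f D x UNIV g]
      has_derivative_transform_eventually[of g D x UNIV f] by auto
qed

lemma frechet_derivative_cong_eventually:
  "eventually (\<lambda>y. f y = g y) (nhds x) \<Longrightarrow> frechet_derivative f (at x) = frechet_derivative g (at x)"
  using has_derivative_cong_eventually[of f g x] by (simp add: frechet_derivative_def)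

lemma differentiable_cong_eventually:
  "eventually (\<lambda>y. f y = g y) (nhds x) \<Longrightarrow> f differentiable (at x) \<Longrightarrow> g differentiable (at x)"
  using has_derivative_cong_eventually[of f g x] by (simp add: differentiable_def)

lemma Ck_on_cong:
  assumes "open U" "\<And>x. x \<in> U \<Longrightarrow> f x = g x" "Ck_on k U f"
  shows "Ck_on k U g"
  using assms(2,3)
proof (induction k arbitrary: f g)
  case 0
  then show ?case using continuous_on_cong[of U U f g] by simp
next
  case (Suc k)
  have ev: "eventually (\<lambda>y. f y = g y) (nhds x)" if "x \<in> U" for x
    using that assms(1) Suc.prems(1) eventually_nhds by blast
  show ?case
    using Suc.prems Suc.IH[OF _ Suc.prems(2)[simplified, THEN conjunct2, rule_format]]
      frechet_derivative_cong_eventually[OF ev] differentiable_cong_eventually[OF ev]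
    by auto
qed

text \<open>Continuity on an open set and differentiability at a point are local, and each
  derivative is again locally of the lower class. This is what allows germs of smooth functions to
  be reassembled into smoothness on a set.\<close>

lemma Ck_on_local:
  assumes "\<And>x. x \<in> U \<Longrightarrow> \<exists>W. open W \<and> x \<in> W \<and> Ck_on k W f"
  shows "Ck_on k U f"
  using assms
proof (induction k arbitrary: f)
  case 0
  have "isCont f x" if "x \<in> U" for x
    using 0[OF that] continuous_on_eq_continuous_at by auto
  then show ?case by (auto intro: continuous_at_imp_continuous_on)
next
  case (Suc k)
  have "f differentiable (at x)" if "x \<in> U" for x
    using Suc.prems[OF that] by auto
  moreover have "Ck_on k U (\<lambda>x. frechet_derivative f (at x) v)" for v
    using Suc.prems by (intro Suc.IH) (metis Ck_on.simps(2))
  ultimately show ?case by simp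
qed

lemma Ck_on_const: "Ck_on k U (\<lambda>_. c)"
  by (induction k arbitrary: c) simp_all

lemma Ck_on_bounded_linear:
  assumes "bounded_linear h" "open U" "Ck_on k U f"
  shows "Ck_on k U (\<lambda>x. h (f x))"
  using assms(3)
proof (induction k arbitrary: f)
  case 0
  then show ?case using assms(1) by (auto intro: bounded_linear.continuous_on)
next
  case (Suc k)
  have d: "((\<lambda>x. h (f x)) has_derivative (\<lambda>v. h (frechet_derivative f (at x) v))) (at x)"
    if "x \<in> U" for x
    using Suc.prems that by (auto intro!: bounded_linear.has_derivative[OF assms(1)] simp: frechet_derivative_works[symmetric])
  have "Ck_on k U (\<lambda>x. frechet_derivative (\<lambda>x. h (f x)) (at x) v)" for v
    by (rule Ck_on_cong[OF assms(2) _ Suc.IH[of "\<lambda>x. frechet_derivative f (at x) v"]])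
      (use Suc.prems frechet_derivative_at[OF d] in \<open>auto simp: fun_eq_iff\<close>)
  then show ?case using d by (auto simp: differentiable_def)
qed

lemma Ck_on_add:
  assumes "open U" "Ck_on k U f" "Ck_on k U g"
  shows "Ck_on k U (\<lambda>x. f x + g x)"
  using assms(2,3)
proof (induction k arbitrary: f g)
  case 0
  then show ?case by (auto intro: continuous_intros)
next
  case (Suc k)
  have d: "((\<lambda>x. f x + g x) has_derivative
      (\<lambda>v. frechet_derivative f (at x) v + frechet_derivative g (at x) v)) (at x)"
    if "x \<in> U" for x
    using Suc.prems that by (auto intro!: has_derivative_add simp: frechet_derivative_works[symmetric])
  have "Ck_on k U (\<lambda>x. frechet_derivative (\<lambda>x. f x + g x) (at x) v)" for v
    by (rule Ck_on_cong[OF assms(1) _ Suc.IH[of "\<lambda>x. frechet_derivative f (at x) v" "\<lambda>x. frechet_derivative g (at x) v"]])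
      (use Suc.prems frechet_derivative_at[OF d] in \<open>auto simp: fun_eq_iff\<close>)
  then show ?case using d by (auto simp: differentiable_def)
qed

lemma Ck_on_sum:
  assumes "open U" "\<And>i. i \<in> A \<Longrightarrow> Ck_on k U (f i)"
  shows "Ck_on k U (\<lambda>x. \<Sum>i\<in>A. f i x)"
  using assms(2)
  by (induction A rule: infinite_finite_induct) (auto intro: Ck_on_const Ck_on_add assms(1))

lemma Ck_on_bounded_bilinear:
  assumes h: "bounded_bilinear h" and "open U" "Ck_on k U f" "Ck_on k U g"
  shows "Ck_on k U (\<lambda>x. h (f x) (g x))"
  using assms(3,4)
proof (induction k arbitrary: f g)
  case 0
  then show ?case using h by (auto intro: bounded_bilinear.continuous_on)
next
  case (Suc k)
  have d: "((\<lambda>x. h (f x) (g x)) has_derivative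
      (\<lambda>v. h (f x) (frechet_derivative g (at x) v) + h (frechet_derivative f (at x) v) (g x))) (at x)"
    if "x \<in> U" for x
    using Suc.prems that by (auto intro!: bounded_bilinear.FDERIV[OF h] simp: frechet_derivative_works[symmetric])
  \<comment> \<open>In each summand of the product rule one factor is left undifferentiated, and the
    induction hypothesis needs it at the lower order.\<close>
  have fg: "Ck_on k U f" "Ck_on k U g" using Suc.prems Ck_on_Suc_imp by blast+
  have "Ck_on k U (\<lambda>x. frechet_derivative (\<lambda>x. h (f x) (g x)) (at x) v)" for v
    by (rule Ck_on_cong[OF assms(2) _ Ck_on_add[OF assms(2)
          Suc.IH[of f "\<lambda>x. frechet_derivative g (at x) v"]
          Suc.IH[of "\<lambda>x. frechet_derivative f (at x) v" g]]])
      (use fg Suc.prems frechet_derivative_at[OF d] in \<open>auto simp: fun_eq_iff\<close>)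
  then show ?case using d by (auto simp: differentiable_def)
qed

text \<open>The derivative of the reciprocal contains the reciprocal itself; the induction on the
  order feeds its regularity of order k back into the derivative.\<close>

lemma Ck_on_inverse:
  fixes f :: "'a::euclidean_space \<Rightarrow> real"
  assumes "open U" "\<And>x. x \<in> U \<Longrightarrow> f x \<noteq> 0" "Ck_on k U f"
  shows "Ck_on k U (\<lambda>x. inverse (f x))"
  using assms(3)
proof (induction k)
  case 0
  then show ?case using assms(2) by (auto intro!: continuous_intros)
next
  case (Suc k)
  have d: "((\<lambda>x. inverse (f x)) has_derivative
      (\<lambda>v. - (inverse (f x) * frechet_derivative f (at x) v * inverse (f x)))) (at x)"
    if "x \<in> U" for x
    using Suc.prems that assms(2) by (auto intro!: has_derivative_inverse simp: frechet_derivative_works[symmetric])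
  have i: "Ck_on k U (\<lambda>x. inverse (f x))" using Suc Ck_on_Suc_imp by blast
  have "Ck_on k U (\<lambda>x. - (inverse (f x) * frechet_derivative f (at x) v * inverse (f x)))" for v
    using Suc.prems
    by (intro Ck_on_bounded_linear[OF bounded_linear_minus[OF bounded_linear_ident]]
        Ck_on_bounded_bilinear[OF bounded_bilinear_mult] i assms(1)) auto
  from Ck_on_cong[OF assms(1) _ this]
  have "Ck_on k U (\<lambda>x. frechet_derivative (\<lambda>x. inverse (f x)) (at x) v)" for v
    using frechet_derivative_at[OF d] by (auto simp: fun_eq_iff)
  then show ?case using d by (auto simp: differentiable_def)
qed

lemma linear_expand_Basis:
  fixes L :: "'a::euclidean_space \<Rightarrow> 'b::real_vector"
  assumes "linear L"
  shows "L u = (\<Sum>b\<in>Basis. (u \<bullet> b) *\<^sub>R L b)"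
  by (metis (no_types, lifting) assms euclidean_representation linear_scale linear_sum sum.cong)

lemma Ck_on_compose:
  fixes f :: "'a::euclidean_space \<Rightarrow> 'b::euclidean_space" and g :: "'b \<Rightarrow> 'c::real_normed_vector"
  assumes "open U" "open V" "f ` U \<subseteq> V" "Ck_on k U f" "Ck_on k V g"
  shows "Ck_on k U (g \<circ> f)"
  using assms(4,5)
proof (induction k arbitrary: g)
  case 0
  then show ?case using assms(3) by (auto simp: comp_def intro: continuous_on_compose2)
next
  case (Suc k)
  have gd: "g differentiable (at (f x))" if "x \<in> U" for x
    using Suc.prems(2) assms(3) that by auto
  have d: "(g \<circ> f has_derivative
      frechet_derivative g (at (f x)) \<circ> frechet_derivative f (at x)) (at x)"
    if "x \<in> U" for x
    using Suc.prems gd[OF that] that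
    by (auto intro!: diff_chain_at simp: frechet_derivative_works[symmetric])
  \<comment> \<open>The chain rule differentiates \<open>g\<close> in a direction that moves with
    \<open>x\<close>, while \<open>Ck_on\<close> controls only fixed directions. Expanding the
    moving direction in the basis reduces to fixed ones with smooth coefficients.\<close>
  have ex: "frechet_derivative (g \<circ> f) (at x) v =
      (\<Sum>b\<in>Basis. (frechet_derivative f (at x) v \<bullet> b) *\<^sub>R frechet_derivative g (at (f x)) b)"
    if "x \<in> U" for x v
    using linear_expand_Basis[OF linear_frechet_derivative[OF gd[OF that]]]
      frechet_derivative_at[OF d[OF that]] by (metis comp_apply)
  have "Ck_on k U (\<lambda>x. frechet_derivative (g \<circ> f) (at x) v)" for v
  proof (rule Ck_on_cong[OF assms(1) ex[symmetric]])
    show "Ck_on k U (\<lambda>x. \<Sum>b\<in>Basis. (frechet_derivative f (at x) v \<bullet> b) *\<^sub>R frechet_derivative g (at (f x)) b)"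
    proof (intro Ck_on_sum Ck_on_bounded_bilinear[OF bounded_bilinear_scaleR]
        Ck_on_bounded_linear[OF bounded_linear_inner_left] assms(1))
      show "Ck_on k U (\<lambda>x. frechet_derivative f (at x) v)" using Suc.prems by simp
      show "Ck_on k U (\<lambda>x. frechet_derivative g (at (f x)) b)" for b
        using Suc.IH[of "\<lambda>y. frechet_derivative g (at y) b"] Suc.prems Ck_on_Suc_imp[OF Suc.prems(1)]
        by (simp add: comp_def)
    qed
  qed simp_all
  moreover have "(g \<circ> f) differentiable (at x)" if "x \<in> U" for x
    using d[OF that] unfolding differentiable_def by blast
  ultimately show ?case unfolding Ck_on.simps by blast
qed

section \<open>Germs of smooth functions\<close>

definition smooth_at :: "('a::euclidean_space \<Rightarrow> 'b::real_normed_vector) \<Rightarrow> 'a \<Rightarrow> bool" where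
  "smooth_at f x \<longleftrightarrow> (\<exists>W. open W \<and> x \<in> W \<and> smooth_on W f)"

lemma smooth_at_if_smooth_on: "open U \<Longrightarrow> x \<in> U \<Longrightarrow> smooth_on U f \<Longrightarrow> smooth_at f x"
  by (auto simp: smooth_at_def)

lemma smooth_on_if_smooth_at: "(\<And>x. x \<in> U \<Longrightarrow> smooth_at f x) \<Longrightarrow> smooth_on U f"
  unfolding smooth_on_def smooth_at_def by (meson Ck_on_local)

lemma smooth_on_subset: "smooth_on U f \<Longrightarrow> V \<subseteq> U \<Longrightarrow> smooth_on V f"
  by (auto simp: smooth_on_def intro: Ck_on_subset)

lemma smooth_at_cong:
  assumes "smooth_at f x" "eventually (\<lambda>y. f y = g y) (nhds x)"
  shows "smooth_at g x"
proof -
  obtain W V where "open W" "x \<in> W" "smooth_on W f" "open V" "x \<in> V" "\<forall>y\<in>V. f y = g y"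
    using assms by (auto simp: smooth_at_def eventually_nhds)
  then have "smooth_on (W \<inter> V) g"
    by (auto simp: smooth_on_def intro!: Ck_on_cong[of "W \<inter> V" f g] intro: Ck_on_subset[of _ W])
  with \<open>open W\<close> \<open>x \<in> W\<close> \<open>open V\<close> \<open>x \<in> V\<close> show ?thesis
    unfolding smooth_at_def by (intro exI[of _ "W \<inter> V"]) auto
qed

lemma smooth_at_imp_differentiable: "smooth_at f x \<Longrightarrow> f differentiable (at x)"
  unfolding smooth_at_def smooth_on_def by (metis Ck_on.simps(2))

lemma smooth_at_frechet_derivative:
  "smooth_at f x \<Longrightarrow> smooth_at (\<lambda>y. frechet_derivative f (at y) v) x"
  unfolding smooth_at_def smooth_on_def by (metis Ck_on.simps(2))

lemma smooth_at_const [simp, intro]: "smooth_at (\<lambda>_. c) x"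
  by (auto simp: smooth_at_def smooth_on_def intro!: exI[of _ UNIV] Ck_on_const)

lemma smooth_at_bounded_linear:
  assumes "bounded_linear h" "smooth_at f x"
  shows "smooth_at (\<lambda>x. h (f x)) x"
proof -
  obtain W where "open W" "x \<in> W" "smooth_on W f" using assms(2) by (auto simp: smooth_at_def)
  then show ?thesis
    by (auto simp: smooth_at_def smooth_on_def intro!: exI[of _ W] Ck_on_bounded_linear[OF assms(1)])
qed

lemma smooth_at_common:
  assumes "smooth_at f x" "smooth_at g x"
  obtains W where "open W" "x \<in> W" "smooth_on W f" "smooth_on W g"
proof -
  obtain W V where "open W" "x \<in> W" "smooth_on W f" "open V" "x \<in> V" "smooth_on V g"
    using assms by (auto simp: smooth_at_def)
  then show ?thesis by (intro that[of "W \<inter> V"]) (auto intro: smooth_on_subset)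
qed

lemma smooth_at_add:
  assumes "smooth_at f x" "smooth_at g x"
  shows "smooth_at (\<lambda>x. f x + g x) x"
  by (rule smooth_at_common[OF assms]) (auto simp: smooth_at_def smooth_on_def intro!: Ck_on_add)

lemma smooth_at_bounded_bilinear:
  assumes "bounded_bilinear h" "smooth_at f x" "smooth_at g x"
  shows "smooth_at (\<lambda>x. h (f x) (g x)) x"
  by (rule smooth_at_common[OF assms(2,3)])
    (auto simp: smooth_at_def smooth_on_def intro!: Ck_on_bounded_bilinear assms(1))

lemmas smooth_at_mult = smooth_at_bounded_bilinear[OF bounded_bilinear_mult]
  and smooth_at_scaleR = smooth_at_bounded_bilinear[OF bounded_bilinear_scaleR]
  and smooth_at_minus = smooth_at_bounded_linear[OF bounded_linear_minus[OF bounded_linear_ident]]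
  and smooth_at_vec_nth = smooth_at_bounded_linear[OF bounded_linear_vec_nth]
  and smooth_at_inner_left = smooth_at_bounded_linear[OF bounded_linear_inner_left]

lemma smooth_at_diff:
  "smooth_at f x \<Longrightarrow> smooth_at g x \<Longrightarrow> smooth_at (\<lambda>x. f x - g x) x"
  using smooth_at_add[of f x "\<lambda>x. - g x"] by (simp add: smooth_at_minus)

lemma smooth_at_sum:
  "(\<And>i. i \<in> A \<Longrightarrow> smooth_at (f i) x) \<Longrightarrow> smooth_at (\<lambda>x. \<Sum>i\<in>A. f i x) x"
  by (induction A rule: infinite_finite_induct) (auto intro: smooth_at_add)

lemma smooth_at_isCont: "smooth_at f x \<Longrightarrow> isCont f x"
  by (simp add: differentiable_imp_continuous_within smooth_at_imp_differentiable)

lemma smooth_at_inverse: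
  fixes f :: "'a::euclidean_space \<Rightarrow> real"
  assumes "smooth_at f x" "f x \<noteq> 0"
  shows "smooth_at (\<lambda>x. inverse (f x)) x"
proof -
  obtain W where W: "open W" "x \<in> W" "smooth_on W f"
    using assms(1) by (auto simp: smooth_at_def)
  obtain V where V: "open V" "x \<in> V" "\<forall>y\<in>V. f y \<noteq> 0"
    using smooth_at_isCont[OF assms(1)] assms(2)
    by (metis continuous_at_avoid openin_open_eq mem_ball open_ball dist_self centre_in_ball)
  show ?thesis unfolding smooth_at_def
    by (rule exI[of _ "W \<inter> V"])
      (use W V in \<open>auto simp: smooth_on_def intro!: Ck_on_inverse intro: Ck_on_subset[of _ W]\<close>)
qed

lemma smooth_at_divide:
  fixes f :: "'a::euclidean_space \<Rightarrow> real"
  assumes "smooth_at f x" "smooth_at g x" "g x \<noteq> 0"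
  shows "smooth_at (\<lambda>x. f x / g x) x"
  using smooth_at_mult[OF assms(1) smooth_at_inverse[OF assms(2,3)]] by (simp add: divide_inverse)

lemma smooth_at_compose:
  fixes f :: "'a::euclidean_space \<Rightarrow> 'b::euclidean_space"
  assumes "smooth_at f x" "smooth_at g (f x)"
  shows "smooth_at (g \<circ> f) x"
proof -
  obtain W where W: "open W" "x \<in> W" "smooth_on W f"
    using assms(1) by (auto simp: smooth_at_def)
  obtain V where V: "open V" "f x \<in> V" "smooth_on V g"
    using assms(2) by (auto simp: smooth_at_def)
  have "continuous_on W f" using W(3) by (metis Ck_on.simps(1) smooth_on_def)
  then have o: "open (W \<inter> f -` V)" using W V continuous_open_preimage by blast
  show ?thesis unfolding smooth_at_def
    by (rule exI[of _ "W \<inter> f -` V"])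
      (use W V o in \<open>auto simp: smooth_on_def intro!: Ck_on_compose[of _ V] intro: Ck_on_subset[of _ W]\<close>)
qed

section \<open>Charts and tangent vectors\<close>

context
  fixes M :: "('a, 'n::finite, 'm) manifold_scheme"
  assumes M: "smooth_manifold M"
begin

lemma chart_openin: "c \<in> matlas M \<Longrightarrow> openin (mtop M) (fst c)"
  using M by (auto simp: smooth_manifold_def topological_chart_def)

lemma chart_homeo: "c \<in> matlas M \<Longrightarrow>
    homeomorphic_map (subtopology (mtop M) (fst c)) (top_of_set (snd c ` fst c)) (snd c)"
  using M by (auto simp: smooth_manifold_def topological_chart_def)

lemma chart_inj: assumes "c \<in> matlas M" shows "inj_on (snd c) (fst c)"
proof -
  have "fst c \<subseteq> mpoints M" using chart_openin[OF assms] openin_subset by blast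
  then show ?thesis
    using homeomorphic_imp_injective_map[OF chart_homeo[OF assms]]
    by (simp add: Int_absorb1)
qed

lemma cinv_left: "c \<in> matlas M \<Longrightarrow> y \<in> fst c \<Longrightarrow> cinv c (snd c y) = y"
  unfolding cinv_def by (simp add: chart_inj)

lemma open_chart_image:
  assumes "c \<in> matlas M" "openin (mtop M) W"
  shows "open (snd c ` (fst c \<inter> W))"
proof -
  have "openin (subtopology (mtop M) (fst c)) (fst c \<inter> W)"
    using assms(2) by (auto simp: openin_subtopology)
  then have "openin (top_of_set (snd c ` fst c)) (snd c ` (fst c \<inter> W))"
    using homeomorphic_imp_open_map[OF chart_homeo[OF assms(1)]] by (simp add: open_map_def)
  moreover have "open (snd c ` fst c)"
    using M assms(1) by (auto simp: smooth_manifold_def topological_chart_def)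
  ultimately show ?thesis using openin_open_trans by blast
qed

lemma charts_at_D: "c \<in> charts_at M x \<Longrightarrow> c \<in> matlas M" "c \<in> charts_at M x \<Longrightarrow> x \<in> fst c"
  by (auto simp: charts_at_def)

lemma charts_at_nonempty: "x \<in> mpoints M \<Longrightarrow> \<exists>c. c \<in> charts_at M x"
  using M unfolding smooth_manifold_def charts_at_def by blast

text \<open>\<open>cinv\<close> is an \<open>inv_into\<close>, meaningful only on the chart image.
  Near \<open>snd c x\<close> it is a true inverse that stays in \<open>W\<close>, so identities on
  open sets of the manifold become identities of germs in coordinates.\<close>

lemma eventually_chart:
  assumes "c \<in> charts_at M x" "openin (mtop M) W" "x \<in> W"
  shows "eventually (\<lambda>p. cinv c p \<in> W \<and> cinv c p \<in> fst c \<and> snd c (cinv c p) = p) (nhds (snd c x))"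
  unfolding eventually_nhds
  by (rule exI[of _ "snd c ` (fst c \<inter> W)"])
    (use assms open_chart_image[of c W] in \<open>auto simp: charts_at_def cinv_left\<close>)

lemma transition_at: "c \<in> charts_at M x \<Longrightarrow> transition c d (snd c x) = snd d x"
  by (simp add: transition_def charts_at_def cinv_left)

lemma transition_smooth:
  assumes "c \<in> charts_at M x" "d \<in> charts_at M x"
  shows "smooth_at (transition c d) (snd c x)"
proof (rule smooth_at_if_smooth_on)
  show "open (snd c ` (fst c \<inter> fst d))"
    using assms by (auto intro: open_chart_image chart_openin dest: charts_at_D)
  show "smooth_on (snd c ` (fst c \<inter> fst d)) (transition c d)"
    using M assms unfolding smooth_manifold_def smoothly_compatible_def charts_at_def by blast
qed (use assms in \<open>auto simp: charts_at_def\<close>)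

lemma transition_differentiable:
  assumes "c \<in> charts_at M x" "d \<in> charts_at M x"
  shows "(transition c d has_derivative frechet_derivative (transition c d) (at (snd c x))) (at (snd c x))"
  using smooth_at_imp_differentiable[OF transition_smooth[OF assms]] frechet_derivative_works by blast

lemma chart_change_eventually:
  assumes "c \<in> charts_at M x" "d \<in> charts_at M x"
  shows "eventually (\<lambda>p. f (cinv d (transition c d p)) = f (cinv c p)) (nhds (snd c x))"
  by (rule eventually_mono[OF eventually_chart[OF assms(1) chart_openin[of d]]])
    (use assms in \<open>auto simp: charts_at_def transition_def cinv_left\<close>)

lemma frechet_derivative_chart_change:
  assumes c: "c \<in> charts_at M x" and d: "d \<in> charts_at M x"
    and f: "(f \<circ> cinv d) differentiable (at (snd d x))"
  shows "(f \<circ> cinv c) differentiable (at (snd c x))"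
    and "frechet_derivative (f \<circ> cinv c) (at (snd c x)) u =
      frechet_derivative (f \<circ> cinv d) (at (snd d x))
        (frechet_derivative (transition c d) (at (snd c x)) u)"
proof -
  have "((f \<circ> cinv d) \<circ> transition c d has_derivative
      frechet_derivative (f \<circ> cinv d) (at (snd d x)) \<circ>
        frechet_derivative (transition c d) (at (snd c x))) (at (snd c x))"
    using transition_differentiable[OF c d] f
    by (intro diff_chain_at) (auto simp: transition_at[OF c] frechet_derivative_works[symmetric])
  moreover have "eventually (\<lambda>p. ((f \<circ> cinv d) \<circ> transition c d) p = (f \<circ> cinv c) p) (nhds (snd c x))"
    using chart_change_eventually[OF c d] by simp
  ultimately have D: "((f \<circ> cinv c) has_derivative
      frechet_derivative (f \<circ> cinv d) (at (snd d x)) \<circ>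
        frechet_derivative (transition c d) (at (snd c x))) (at (snd c x))"
    using has_derivative_cong_eventually by blast
  then show "(f \<circ> cinv c) differentiable (at (snd c x))" by (auto simp: differentiable_def)
  show "frechet_derivative (f \<circ> cinv c) (at (snd c x)) u =
      frechet_derivative (f \<circ> cinv d) (at (snd d x))
        (frechet_derivative (transition c d) (at (snd c x)) u)"
    using frechet_derivative_at[OF D] by (metis comp_apply)
qed

text \<open>The cocycle rule is the chart change formula for the coordinate map of \<open>e\<close>,
  because \<open>transition d e\<close> is that map read in the chart \<open>d\<close>.\<close>

lemma transition_derivative_comp:
  assumes "c \<in> charts_at M x" "d \<in> charts_at M x" "e \<in> charts_at M x"
  shows "frechet_derivative (transition d e) (at (snd d x)) (frechet_derivative (transition c d) (at (snd c x)) u)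
    = frechet_derivative (transition c e) (at (snd c x)) u"
proof -
  have "(snd e \<circ> cinv d) differentiable (at (snd d x))"
    using smooth_at_imp_differentiable[OF transition_smooth[OF assms(2,3)]] by (simp only: transition_def)
  from frechet_derivative_chart_change(2)[OF assms(1,2) this, symmetric]
  show ?thesis unfolding transition_def .
qed

lemma transition_derivative_refl:
  assumes "c \<in> charts_at M x"
  shows "frechet_derivative (transition c c) (at (snd c x)) u = u"
proof -
  have "eventually (\<lambda>p. transition c c p = p) (nhds (snd c x))"
    by (rule eventually_mono[OF eventually_chart[OF assms chart_openin[of c]]])
      (use assms in \<open>auto simp: charts_at_def transition_def cinv_left\<close>)
  from frechet_derivative_cong_eventually[OF this] show ?thesis by simp
qed

lemma tangent_of_self: "c \<in> charts_at M x \<Longrightarrow> tangent_of M c x u c = u"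
  by (simp add: tangent_of_def transition_derivative_refl)

lemma tangent_of_in_tangent_space: "c \<in> charts_at M x \<Longrightarrow> tangent_of M c x u \<in> tangent_space M x"
  unfolding tangent_space_def
proof (intro CollectI conjI ballI allI impI)
  fix d e assume "c \<in> charts_at M x" "d \<in> charts_at M x" "e \<in> charts_at M x"
  then show "tangent_of M c x u e =
      frechet_derivative (transition d e) (at (snd d x)) (tangent_of M c x u d)"
    unfolding tangent_of_def by (simp only: if_True transition_derivative_comp)
qed (simp add: tangent_of_def)

text \<open>One component determines the whole family: the transformation law gives the other
  components at charts around the point, and the normalisation gives zero elsewhere.\<close>

lemma tangent_eq_tangent_of:
  assumes "c \<in> charts_at M x" "v \<in> tangent_space M x"
  shows "v = tangent_of M c x (v c)"
proof
  fix d
  have "d \<in> charts_at M x \<Longrightarrow> v d = frechet_derivative (transition c d) (at (snd c x)) (v c)"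
    and "d \<notin> charts_at M x \<Longrightarrow> v d = 0"
    using assms unfolding tangent_space_def by blast+
  then show "v d = tangent_of M c x (v c) d" unfolding tangent_of_def by presburger
qed

lemma tangent_eqI:
  assumes "c \<in> charts_at M x" "v \<in> tangent_space M x" "w \<in> tangent_space M x" "v c = w c"
  shows "v = w"
proof -
  have "v = tangent_of M c x (w c)" using tangent_eq_tangent_of[OF assms(1,2)] unfolding assms(4) .
  also have "\<dots> = w" using tangent_eq_tangent_of[OF assms(1,3)] by (rule HOL.sym)
  finally show ?thesis .
qed

lemma transition_derivative_linear:
  "c \<in> charts_at M x \<Longrightarrow> d \<in> charts_at M x \<Longrightarrow> linear (frechet_derivative (transition c d) (at (snd c x)))"
  using transition_differentiable has_derivative_linear by blast

lemma tangent_sum: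
  assumes "\<And>i. i \<in> A \<Longrightarrow> v i \<in> tangent_space M x"
  shows "(\<lambda>c. \<Sum>i\<in>A. s i *\<^sub>R v i c) \<in> tangent_space M x"
  unfolding tangent_space_def
proof (intro CollectI conjI ballI allI impI)
  fix c d assume c: "c \<in> charts_at M x" and d: "d \<in> charts_at M x"
  have v: "v i d = frechet_derivative (transition c d) (at (snd c x)) (v i c)" if "i \<in> A" for i
    using assms[OF that] c d unfolding tangent_space_def by blast
  show "(\<Sum>i\<in>A. s i *\<^sub>R v i d) =
      frechet_derivative (transition c d) (at (snd c x)) (\<Sum>i\<in>A. s i *\<^sub>R v i c)"
    by (simp add: v linear_sum[OF transition_derivative_linear[OF c d]] linear_scale[OF transition_derivative_linear[OF c d]])
next
  fix c assume "c \<notin> charts_at M x"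
  then have "v i c = 0" if "i \<in> A" for i
    using assms[OF that] unfolding tangent_space_def by blast
  then show "(\<Sum>i\<in>A. s i *\<^sub>R v i c) = 0" by simp
qed

lemma tangent_zero: "(\<lambda>_. 0) \<in> tangent_space M x"
proof -
  have "(\<lambda>c. \<Sum>i\<in>{}. (0::real) *\<^sub>R 0) \<in> tangent_space M x"
    by (rule tangent_sum) blast
  then show ?thesis by simp
qed

lemma covectorD:
  "covector M x \<alpha> \<Longrightarrow> v \<in> tangent_space M x \<Longrightarrow> w \<in> tangent_space M x \<Longrightarrow>
    \<alpha> (\<lambda>c. s *\<^sub>R v c + t *\<^sub>R w c) = s * \<alpha> v + t * \<alpha> w"
  unfolding covector_def by blast

lemma covector_zero: assumes "covector M x \<alpha>" shows "\<alpha> (\<lambda>_. 0) = 0"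
  using covectorD[OF assms tangent_zero tangent_zero, where s = 0 and t = 0] by simp

lemma covector_sum:
  assumes \<alpha>: "covector M x \<alpha>" and v: "\<And>i. i \<in> A \<Longrightarrow> v i \<in> tangent_space M x"
  shows "\<alpha> (\<lambda>c. \<Sum>i\<in>A. s i *\<^sub>R v i c) = (\<Sum>i\<in>A. s i * \<alpha> (v i))"
  using v
proof (induction A rule: infinite_finite_induct)
  case (insert a A)
  have "\<alpha> (\<lambda>c. s a *\<^sub>R v a c + 1 *\<^sub>R (\<Sum>i\<in>A. s i *\<^sub>R v i c)) =
      s a * \<alpha> (v a) + 1 * \<alpha> (\<lambda>c. \<Sum>i\<in>A. s i *\<^sub>R v i c)"
    by (intro covectorD[OF \<alpha>] tangent_sum insert.prems) simp_all
  then show ?case using insert by simp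
qed (simp_all add: covector_zero[OF \<alpha>])

text \<open>\<open>differential\<close> picks a chart by \<open>SOME\<close>; the chain rule cancels
  against the transformation law of \<open>v\<close>, so any chart around the point may be used
  instead.\<close>

lemma differential_eq:
  assumes "c \<in> charts_at M x" "(f \<circ> cinv c) differentiable (at (snd c x))" "v \<in> tangent_space M x"
  shows "differential M f x v = frechet_derivative (f \<circ> cinv c) (at (snd c x)) (v c)"
proof -
  define d where "d = (SOME c. c \<in> charts_at M x)"
  have d: "d \<in> charts_at M x" unfolding d_def using assms(1) by (rule someI)
  have "v c = frechet_derivative (transition d c) (at (snd d x)) (v d)"
    using assms(1,3) d unfolding tangent_space_def by blast
  then show ?thesis
    using frechet_derivative_chart_change(2)[OF d assms(1,2), of "v d"]
    by (simp add: differential_def Let_def d_def)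
qed

lemma smooth_at_chart_change:
  assumes c: "c \<in> charts_at M x" and d: "d \<in> charts_at M x"
    and f: "smooth_at (f \<circ> cinv d) (snd d x)"
  shows "smooth_at (f \<circ> cinv c) (snd c x)"
proof (rule smooth_at_cong)
  show "smooth_at ((f \<circ> cinv d) \<circ> transition c d) (snd c x)"
    by (rule smooth_at_compose[OF transition_smooth[OF c d]]) (simp add: transition_at[OF c] f)
qed (use chart_change_eventually[OF c d] in simp)

lemma smooth_fun_onI:
  assumes "\<And>x. x \<in> U \<Longrightarrow> \<exists>c\<in>charts_at M x. smooth_at (f \<circ> cinv c) (snd c x)"
  shows "smooth_fun_on M U f"
  unfolding smooth_fun_on_def
proof (intro ballI smooth_on_if_smooth_at)
  fix c p assume c: "c \<in> matlas M" "p \<in> snd c ` (fst c \<inter> U)"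
  then obtain x where x: "x \<in> fst c" "x \<in> U" "p = snd c x" by auto
  then obtain d where "d \<in> charts_at M x" "smooth_at (f \<circ> cinv d) (snd d x)" using assms by blast
  moreover have "c \<in> charts_at M x" using c x by (simp add: charts_at_def)
  ultimately show "smooth_at (f \<circ> cinv c) p" using smooth_at_chart_change x(3) by blast
qed

lemma smooth_vfield_at:
  assumes "smooth_vfield_on M U X" "openin (mtop M) U" "x \<in> U" "c \<in> charts_at M x"
  shows "smooth_at (\<lambda>p. X (cinv c p) c) (snd c x)"
  using assms open_chart_image[of c U]
  by (intro smooth_at_if_smooth_on[of "snd c ` (fst c \<inter> U)"])
    (auto simp: smooth_vfield_on_def charts_at_def)

text \<open>Smoothness of a metric is given only on vectors with constant components in a chart.
  Expanding \<open>X\<close> and \<open>Y\<close> in the coordinate vectors of \<open>d\<close>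
  extends it to vectors along a map \<open>\<gamma>\<close>. The base point is allowed to move by a
  map so that the metric of the target manifold can be evaluated along a diffeomorphism read in a
  chart.\<close>

lemma smooth_metric_along:
  fixes \<gamma> :: "'e::euclidean_space \<Rightarrow> 'a"
  assumes g: "riemannian_metric M g" and d: "d \<in> charts_at M (\<gamma> p)"
    and ev: "eventually (\<lambda>q. d \<in> charts_at M (\<gamma> q) \<and> X q \<in> tangent_space M (\<gamma> q) \<and>
        Y q \<in> tangent_space M (\<gamma> q)) (nhds p)"
    and sm: "smooth_at (\<lambda>q. snd d (\<gamma> q)) p"
    and X: "smooth_at (\<lambda>q. X q d) p" and Y: "smooth_at (\<lambda>q. Y q d) p"
  shows "smooth_at (\<lambda>q. g (\<gamma> q) (X q) (Y q)) p"
proof -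
  define b :: "'n \<Rightarrow> 'a \<Rightarrow> ('a, 'n) tangent" where "b i y = tangent_of M d y (axis i 1)" for i y
  define H where "H i j y = g y (b i y) (b j y)" for i j y
  have dm: "d \<in> matlas M" "\<gamma> p \<in> fst d" using d by (auto simp: charts_at_def)
  have expand: "v = (\<lambda>c. \<Sum>i\<in>UNIV. (v d $ i) *\<^sub>R b i y c)"
    if "d \<in> charts_at M y" "v \<in> tangent_space M y" for y v
  proof (rule tangent_eqI[OF that(1,2)])
    show "(\<lambda>c. \<Sum>i\<in>UNIV. (v d $ i) *\<^sub>R b i y c) \<in> tangent_space M y"
      unfolding b_def by (intro tangent_sum tangent_of_in_tangent_space that)
    show "v d = (\<Sum>i\<in>UNIV. (v d $ i) *\<^sub>R b i y d)"
      unfolding b_def tangent_of_self[OF that(1)]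
      using basis_expansion[of "v d"] by (simp add: scalar_mult_eq_scaleR)
  qed
  have bt: "b i y \<in> tangent_space M y" if "d \<in> charts_at M y" for i y
    unfolding b_def by (rule tangent_of_in_tangent_space[OF that])
  have pt: "y \<in> mpoints M" if "d \<in> charts_at M y" for y
    using chart_openin[of d] that openin_subset by (fastforce simp: charts_at_def)
  have form: "g y v w = (\<Sum>i\<in>UNIV. \<Sum>j\<in>UNIV. v d $ i * (w d $ j) * H i j y)"
    if d: "d \<in> charts_at M y" and v: "v \<in> tangent_space M y" and w: "w \<in> tangent_space M y" for y v w
  proof -
    have cov: "covector M y (g y u)" if "u \<in> tangent_space M y" for u
      using g pt[OF d] that by (auto simp: riemannian_metric_def)
    \<comment> \<open>\<open>riemannian_metric\<close> states linearity in the second argument only;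
      symmetry carries it over to the first.\<close>
    have sym: "g y u u' = g y u' u" if "u \<in> tangent_space M y" "u' \<in> tangent_space M y" for u u'
      using g pt[OF d] that by (auto simp: riemannian_metric_def)
    have e1: "g y u w = (\<Sum>j\<in>UNIV. w d $ j * g y u (b j y))" if "u \<in> tangent_space M y" for u
      using arg_cong[OF expand[OF d w], of "g y u"]
        covector_sum[OF cov[OF that], of UNIV "\<lambda>j. b j y" "\<lambda>j. w d $ j", OF bt[OF d]]
      by (rule trans)
    have "g y v w = g y w v" by (rule sym[OF v w])
    also have "\<dots> = (\<Sum>i\<in>UNIV. v d $ i * g y w (b i y))"
      using arg_cong[OF expand[OF d v], of "g y w"]
        covector_sum[OF cov[OF w], of UNIV "\<lambda>j. b j y" "\<lambda>j. v d $ j", OF bt[OF d]]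
      by (rule trans)
    also have "\<dots> = (\<Sum>i\<in>UNIV. v d $ i * (\<Sum>j\<in>UNIV. w d $ j * g y (b i y) (b j y)))"
      using e1[OF bt[OF d]] sym[OF w bt[OF d]] by simp
    finally show ?thesis by (simp add: H_def sum_distrib_left mult.assoc)
  qed
  have H: "smooth_at (\<lambda>q. H i j (\<gamma> q)) p" for i j
  proof -
    have "smooth_on (snd d ` fst d) (\<lambda>q. H i j (cinv d q))"
      using g dm unfolding H_def b_def riemannian_metric_def by blast
    moreover have "open (snd d ` fst d)"
      using open_chart_image[OF dm(1) chart_openin[OF dm(1)]] by simp
    ultimately have "smooth_at (\<lambda>q. H i j (cinv d q)) (snd d (\<gamma> p))"
      using dm by (auto intro: smooth_at_if_smooth_on)
    from smooth_at_compose[OF sm this]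
    show ?thesis
      by (rule smooth_at_cong) (use ev dm in \<open>auto simp: charts_at_def cinv_left elim: eventually_mono\<close>)
  qed
  show ?thesis
  proof (rule smooth_at_cong)
    show "smooth_at (\<lambda>q. \<Sum>i\<in>UNIV. \<Sum>j\<in>UNIV. X q d $ i * (Y q d $ j) * H i j (\<gamma> q)) p"
      by (intro smooth_at_sum smooth_at_mult smooth_at_vec_nth X Y H)
    show "eventually (\<lambda>q. (\<Sum>i\<in>UNIV. \<Sum>j\<in>UNIV. X q d $ i * (Y q d $ j) * H i j (\<gamma> q)) =
        g (\<gamma> q) (X q) (Y q)) (nhds p)"
      using ev by eventually_elim (simp add: form)
  qed
qed

end

section \<open>Push-forward of tangent vectors by a smooth map\<close>

context
  fixes M :: "('a, 'n::finite, 'm) manifold_scheme" and N :: "('b, 'k::finite, 'l) manifold_scheme"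
    and f :: "'a \<Rightarrow> 'b"
  assumes M: "smooth_manifold M" and N: "smooth_manifold N" and f: "smooth_map M N f"
begin

lemma smooth_map_preimage: "openin (mtop N) W \<Longrightarrow> openin (mtop M) {x \<in> mpoints M. f x \<in> W}"
  using f by (auto simp: smooth_map_def continuous_map_def)

lemma chart_in_mpoints: "c \<in> charts_at M x \<Longrightarrow> x \<in> mpoints M"
  using chart_openin[OF M, of c] openin_subset by (fastforce simp: charts_at_def)

lemma smooth_map_eventually:
  assumes "c \<in> charts_at M x" "d \<in> charts_at N (f x)"
  shows "eventually (\<lambda>p. c \<in> charts_at M (cinv c p) \<and> d \<in> charts_at N (f (cinv c p)) \<and>
     snd c (cinv c p) = p) (nhds (snd c x))"
  by (rule eventually_mono[OF eventually_chart[OF M assms(1) smooth_map_preimage[OF chart_openin[OF N, of d]]]])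
    (use assms chart_in_mpoints in \<open>auto simp: charts_at_def\<close>)

lemma smooth_map_smooth_at:
  assumes "c \<in> charts_at M x" "d \<in> charts_at N (f x)"
  shows "smooth_at (snd d \<circ> f \<circ> cinv c) (snd c x)"
proof (rule smooth_at_if_smooth_on)
  have dm: "c \<in> matlas M" "d \<in> matlas N" using assms by (auto simp: charts_at_def)
  then show "smooth_on (snd c ` {x \<in> fst c. f x \<in> fst d}) (snd d \<circ> f \<circ> cinv c)"
    using f by (auto simp: smooth_map_def)
  have "fst c \<subseteq> mpoints M" using chart_openin[OF M dm(1)] openin_subset by blast
  then have "fst c \<inter> {x \<in> mpoints M. f x \<in> fst d} = {x \<in> fst c. f x \<in> fst d}" by auto
  then show "open (snd c ` {x \<in> fst c. f x \<in> fst d})"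
    using open_chart_image[OF M dm(1) smooth_map_preimage[OF chart_openin[OF N dm(2)]]] by simp
qed (use assms in \<open>auto simp: charts_at_def\<close>)

lemma pushforward_chart:
  assumes "c \<in> charts_at M x" "d \<in> charts_at N (f x)" "v \<in> tangent_space M x"
  shows "pushforward M N f x v d = frechet_derivative (snd d \<circ> f \<circ> cinv c) (at (snd c x)) (v c)"
  using assms differential_eq[OF M assms(1) smooth_at_imp_differentiable[OF smooth_map_smooth_at[OF assms(1,2)]] assms(3)]
  by (simp add: pushforward_def)

text \<open>The transformation law is the chain rule for \<open>transition d d'\<close> composed
  with the local form of \<open>f\<close>, which near the point is the local form of
  \<open>f\<close> with respect to \<open>d'\<close>.\<close>

lemma pushforward_in_tangent_space:
  assumes "x \<in> mpoints M" "v \<in> tangent_space M x"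
  shows "pushforward M N f x v \<in> tangent_space N (f x)"
proof -
  obtain c where c: "c \<in> charts_at M x" using charts_at_nonempty[OF M assms(1)] by blast
  have "pushforward M N f x v d' =
      frechet_derivative (transition d d') (at (snd d (f x))) (pushforward M N f x v d)"
    if d: "d \<in> charts_at N (f x)" "d' \<in> charts_at N (f x)" for d d'
  proof -
    let ?F = "snd d \<circ> f \<circ> cinv c"
    have "(transition d d' \<circ> ?F has_derivative
        frechet_derivative (transition d d') (at (?F (snd c x))) \<circ> frechet_derivative ?F (at (snd c x)))
        (at (snd c x))"
      using smooth_at_imp_differentiable[OF smooth_map_smooth_at[OF c d(1)]]
        transition_differentiable[OF N d] c
      by (intro diff_chain_at) (auto simp: frechet_derivative_works[symmetric] charts_at_def cinv_left[OF M])
    moreover have "eventually (\<lambda>p. (transition d d' \<circ> ?F) p = (snd d' \<circ> f \<circ> cinv c) p) (nhds (snd c x))"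
      using smooth_map_eventually[OF c d(1)]
      by eventually_elim (auto simp: transition_def charts_at_def cinv_left[OF N])
    ultimately have "((snd d' \<circ> f \<circ> cinv c) has_derivative
        frechet_derivative (transition d d') (at (?F (snd c x))) \<circ> frechet_derivative ?F (at (snd c x)))
        (at (snd c x))"
      using has_derivative_cong_eventually by blast
    from frechet_derivative_at[OF this] show ?thesis
      using pushforward_chart[OF c d(1) assms(2)] pushforward_chart[OF c d(2) assms(2)] c
      by (auto simp: fun_eq_iff charts_at_def cinv_left[OF M])
  qed
  moreover have "pushforward M N f x v d = 0" if "d \<notin> charts_at N (f x)" for d
    using that by (simp add: pushforward_def)
  ultimately show ?thesis unfolding tangent_space_def by blast
qed

lemma pushforward_sum:
  assumes "x \<in> mpoints M" "\<And>i. i \<in> A \<Longrightarrow> v i \<in> tangent_space M x"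
  shows "pushforward M N f x (\<lambda>c. \<Sum>i\<in>A. s i *\<^sub>R v i c) =
    (\<lambda>d. \<Sum>i\<in>A. s i *\<^sub>R pushforward M N f x (v i) d)"
proof
  fix d
  obtain c where c: "c \<in> charts_at M x" using charts_at_nonempty[OF M assms(1)] by blast
  show "pushforward M N f x (\<lambda>c. \<Sum>i\<in>A. s i *\<^sub>R v i c) d =
    (\<Sum>i\<in>A. s i *\<^sub>R pushforward M N f x (v i) d)"
  proof (cases "d \<in> charts_at N (f x)")
    case True
    have "linear (frechet_derivative (snd d \<circ> f \<circ> cinv c) (at (snd c x)))"
      by (intro linear_frechet_derivative smooth_at_imp_differentiable smooth_map_smooth_at c True)
    then show ?thesis
      using pushforward_chart[OF c True tangent_sum[OF M, of A v x s]] pushforward_chart[OF c True] assms(2)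
      by (simp add: linear_sum linear_scale)
  qed (simp add: pushforward_def)
qed

text \<open>As in the chain rule, the direction of differentiation varies with the point, so the
  derivative of the local form of \<open>f\<close> is expanded over fixed basis directions.\<close>

lemma smooth_pushforward_at:
  assumes "smooth_vfield_on M U X" "openin (mtop M) U" "x \<in> U"
    and c: "c \<in> charts_at M x" and d: "d \<in> charts_at N (f x)"
  shows "smooth_at (\<lambda>p. pushforward M N f (cinv c p) (X (cinv c p)) d) (snd c x)"
proof (rule smooth_at_cong)
  let ?F = "snd d \<circ> f \<circ> cinv c"
  show "smooth_at (\<lambda>p. \<Sum>b\<in>Basis. (X (cinv c p) c \<bullet> b) *\<^sub>R frechet_derivative ?F (at p) b) (snd c x)"
    by (intro smooth_at_sum smooth_at_scaleR smooth_at_inner_left smooth_at_frechet_derivative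
        smooth_map_smooth_at c d smooth_vfield_at[OF M assms(1-3)])
  show "eventually (\<lambda>p. (\<Sum>b\<in>Basis. (X (cinv c p) c \<bullet> b) *\<^sub>R frechet_derivative ?F (at p) b) =
      pushforward M N f (cinv c p) (X (cinv c p)) d) (nhds (snd c x))"
    using smooth_map_eventually[OF c d] eventually_chart[OF M c assms(2,3)]
  proof eventually_elim
    case (elim p)
    let ?y = "cinv c p"
    have X: "X ?y \<in> tangent_space M ?y" using assms(1) elim by (auto simp: smooth_vfield_on_def)
    have "linear (frechet_derivative ?F (at (snd c ?y)))"
      using elim by (intro linear_frechet_derivative smooth_at_imp_differentiable smooth_map_smooth_at) auto
    then show ?case
      using linear_expand_Basis[of "frechet_derivative ?F (at p)" "X ?y c"]
        pushforward_chart[OF _ _ X, of c d] elim by simp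
  qed
qed

end

section \<open>Planes on which a symmetric map is conformal\<close>

text \<open>Subtracting from \<open>x\<close> and \<open>y\<close> their components along
  \<open>n\<close> gives arguments on which the form vanishes, so the form is determined by
  \<open>R n\<close>. The first term of \<open>m\<close> alone would count the value on the pair
  \<open>n\<close>, \<open>n\<close> twice; the second term removes the surplus.\<close>

lemma symmetric_form_vanishing_on_hyperplane:
  fixes R :: "'v::real_inner \<Rightarrow> 'v"
  assumes lin: "linear R" and sym: "\<And>x y. R x \<bullet> y = x \<bullet> R y" and n: "n \<noteq> 0"
    and van: "\<And>s t. n \<bullet> s = 0 \<Longrightarrow> n \<bullet> t = 0 \<Longrightarrow> s \<bullet> R t = 0"
    and m: "m = (2 / (n \<bullet> n)) *\<^sub>R R n - ((n \<bullet> R n) / (n \<bullet> n)\<^sup>2) *\<^sub>R n"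
  shows "R x = (1/2) *\<^sub>R ((n \<bullet> x) *\<^sub>R m + (m \<bullet> x) *\<^sub>R n)"
proof -
  define N where "N = n \<bullet> n"
  have N: "N \<noteq> 0" using n by (simp add: N_def)
  have "y \<bullet> R x = y \<bullet> ((1/2) *\<^sub>R ((n \<bullet> x) *\<^sub>R m + (m \<bullet> x) *\<^sub>R n))" for y
  proof -
    have "n \<bullet> (z - (n \<bullet> z / N) *\<^sub>R n) = 0" for z
      using N by (simp add: inner_diff_right N_def[symmetric])
    from van[OF this[of y] this[of x]]
    have "y \<bullet> R x = (n \<bullet> x / N) * (y \<bullet> R n) + (n \<bullet> y / N) * (n \<bullet> R x)
        - (n \<bullet> x / N) * (n \<bullet> y / N) * (n \<bullet> R n)"
      by (simp add: linear_diff[OF lin] linear_scale[OF lin] inner_diff algebra_simps)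
    also have "n \<bullet> R x = R n \<bullet> x" by (simp add: sym)
    also have "(n \<bullet> x / N) * (y \<bullet> R n) + (n \<bullet> y / N) * (R n \<bullet> x)
        - (n \<bullet> x / N) * (n \<bullet> y / N) * (n \<bullet> R n) =
        y \<bullet> ((1/2) *\<^sub>R ((n \<bullet> x) *\<^sub>R m + (m \<bullet> x) *\<^sub>R n))"
      unfolding m N_def[symmetric] using N
      by (simp add: inner_add_right inner_diff inner_commute[of y n] field_simps power2_eq_square)
    finally show ?thesis .
  qed
  then show ?thesis by (metis vector_eq_ldot)
qed

unbundle cross3_syntax

lemma cross_zero_iff_parallel:
  fixes m n :: "real^3"
  assumes "n \<noteq> 0" "m \<times> n = 0"
  shows "m = (m \<bullet> n / (n \<bullet> n)) *\<^sub>R n"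
proof -
  have "n \<times> (m \<times> n) = (n \<bullet> n) *\<^sub>R m - (n \<bullet> m) *\<^sub>R n" by (simp add: Lagrange)
  then have "(n \<bullet> n) *\<^sub>R m = (m \<bullet> n) *\<^sub>R n" using assms by (simp add: inner_commute)
  then have "(1 / (n \<bullet> n)) *\<^sub>R (n \<bullet> n) *\<^sub>R m = (1 / (n \<bullet> n)) *\<^sub>R (m \<bullet> n) *\<^sub>R n" by simp
  then show ?thesis using assms by simp
qed

text \<open>The symmetrised product of \<open>m\<close> and \<open>n\<close> has the eigenvalues \<open>0\<close> and
  \<open>(m \<bullet> n \<plusminus> norm m * norm n) / 2\<close>, with eigenvectors \<open>m \<times> n\<close> and \<open>norm n m \<plusminus> norm m n\<close>.\<close>

lemma symmetric_product_spectrum: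
  fixes m n :: "real^3" and A :: "real^3 \<Rightarrow> real^3"
  assumes A: "\<And>x. A x = (1/2) *\<^sub>R ((n \<bullet> x) *\<^sub>R m + (m \<bullet> x) *\<^sub>R n) + r *\<^sub>R x"
    and spec: "{l. \<exists>v. v \<noteq> 0 \<and> A v = l *\<^sub>R v} = {l1, l2, l3}"
    and l: "l1 < l2" "l2 < l3" and n: "n \<noteq> 0"
  shows "m \<times> n \<noteq> 0" "r = l2" "4 * ((l2 - l1) * (l3 - l2)) = (m \<times> n) \<bullet> (m \<times> n)"
proof -
  show mn: "m \<times> n \<noteq> 0"
  proof
    assume "m \<times> n = 0"
    then obtain k where k: "m = k *\<^sub>R n" using cross_zero_iff_parallel[OF n] by blast
    \<comment> \<open>With \<open>m\<close> parallel to \<open>n\<close>, the map \<open>A\<close>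
      is \<open>r\<close> times the identity plus a multiple of the projection to \<open>n\<close>,
      which leaves room for at most two eigenvalues.\<close>
    have "l = r \<or> l = k * (n \<bullet> n) + r" if lin: "l \<in> {l1, l2, l3}" for l
    proof -
      obtain v where v: "v \<noteq> 0" "A v = l *\<^sub>R v" using lin spec by blast
      have e: "(l - r) *\<^sub>R v = (k * (n \<bullet> v)) *\<^sub>R n"
        using v(2) unfolding A k by (simp add: algebra_simps flip: scaleR_add_left)
      then have "(l - r) * (n \<bullet> v) = k * (n \<bullet> n) * (n \<bullet> v)"
        by (metis inner_scaleR_right mult.commute mult.left_commute)
      moreover have "l = r" if "n \<bullet> v = 0" using e v that by simp
      ultimately show ?thesis by auto
    qed
    from this[of l1] this[of l2] this[of l3] l show False by auto
  qed
  then have m: "m \<noteq> 0" by auto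
  define k where "k = norm m * norm n"
  have eig: "r + (m \<bullet> n + s * k) / 2 \<in> {l1, l2, l3}" if s: "s = 1 \<or> s = -1" for s
  proof -
    define v where "v = norm n *\<^sub>R m + (s * norm m) *\<^sub>R n"
    \<comment> \<open>The cross product with \<open>n\<close> removes the \<open>n\<close> part of
      \<open>v\<close>, so \<open>v\<close> cannot vanish for either sign.\<close>
    have "v \<times> n = norm n *\<^sub>R (m \<times> n)" by (simp add: v_def cross_add_left cross_mult_left)
    then have "v \<noteq> 0" using mn n by auto
    moreover have "A v = (r + (m \<bullet> n + s * k) / 2) *\<^sub>R v"
    proof -
      have "n \<bullet> v = norm n * (m \<bullet> n + s * k)" "m \<bullet> v = s * norm m * (m \<bullet> n + s * k)"
        using s by (auto simp: v_def k_def inner_add_right inner_commute[of n m] dot_square_norm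
            power2_eq_square algebra_simps)
      then show ?thesis unfolding A by (simp add: v_def scaleR_add_right scaleR_add_left algebra_simps add_divide_distrib)
    qed
    ultimately show ?thesis using spec by blast
  qed
  have "A (m \<times> n) = r *\<^sub>R (m \<times> n)" unfolding A by (simp add: dot_cross_self)
  then have "r \<in> {l1, l2, l3}" using spec mn by blast
  have nc: "(norm (m \<times> n))\<^sup>2 + (m \<bullet> n)\<^sup>2 = k\<^sup>2" unfolding k_def by (rule norm_cross_dot)
  have "(norm (m \<times> n))\<^sup>2 > 0" using mn by simp
  then have "(m \<bullet> n)\<^sup>2 < k\<^sup>2" using nc by linarith
  moreover have "k \<ge> 0" by (simp add: k_def)
  ultimately have ab: "\<bar>m \<bullet> n\<bar> < k" using abs_less_iff power2_less_imp_less[of "\<bar>m \<bullet> n\<bar>" k] by simp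
  \<comment> \<open>By the strict Cauchy-Schwarz inequality \<open>ab\<close>, the value with
    \<open>s = -1\<close> lies below \<open>r\<close> and the value with \<open>s = 1\<close> above
    it. All three lie in the spectrum, so they are \<open>l1\<close>, \<open>l2\<close>,
    \<open>l3\<close> in this order.\<close>
  have L: "l1 = r + (m \<bullet> n - k) / 2 \<and> l2 = r \<and> l3 = r + (m \<bullet> n + k) / 2"
    using eig[of 1] eig[of "-1"] \<open>r \<in> _\<close> ab l by auto
  then show "r = l2" by simp
  have d: "l2 - l1 = (k - m \<bullet> n) / 2" "l3 - l2 = (k + m \<bullet> n) / 2"
    using L by (auto simp: field_simps)
  have e: "(m \<times> n) \<bullet> (m \<times> n) = k\<^sup>2 - (m \<bullet> n)\<^sup>2"
    using nc unfolding power2_norm_eq_inner by linarith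
  show "4 * ((l2 - l1) * (l3 - l2)) = (m \<times> n) \<bullet> (m \<times> n)"
    unfolding d e by (simp add: power2_eq_square field_simps)
qed

text \<open>The shifted map \<open>A - l2\<close> is the symmetric part of the rank one map \<open>s \<mapsto> (n \<bullet> s) m\<close>,
  whose antisymmetric part is a multiple of the cross product with the middle eigenvector; the
  formula for \<open>\<mu>\<close> does not change when \<open>n\<close> is rescaled.\<close>

lemma conformal_plane:
  fixes A :: "real^3 \<Rightarrow> real^3" and b n :: "real^3"
  assumes lin: "linear A" and sym: "\<And>x y. A x \<bullet> y = x \<bullet> A y" and n: "n \<noteq> 0"
    and conf: "\<And>s t. n \<bullet> s = 0 \<Longrightarrow> n \<bullet> t = 0 \<Longrightarrow> s \<bullet> A t = r * (s \<bullet> t)"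
    and spec: "{l. \<exists>v. v \<noteq> 0 \<and> A v = l *\<^sub>R v} = {l1, l2, l3}"
    and l: "l1 < l2" "l2 < l3" and b: "b \<bullet> b = 1" "A b = l2 *\<^sub>R b"
    and \<mu>: "\<mu> = b \<bullet> (A n \<times> n) / (n \<bullet> n)"
  shows "\<mu>\<^sup>2 = (l2 - l1) * (l3 - l2)"
    and "\<exists>m. \<forall>s. A s - l2 *\<^sub>R s + \<mu> *\<^sub>R (s \<times> b) = (n \<bullet> s) *\<^sub>R m"
proof -
  define R where "R x = A x - r *\<^sub>R x" for x
  define m where "m = (2 / (n \<bullet> n)) *\<^sub>R R n - ((n \<bullet> R n) / (n \<bullet> n)\<^sup>2) *\<^sub>R n"
  have "linear R" unfolding R_def
    by (intro linear_compose_sub lin) (simp add: linear_scale_self)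
  then have R: "R x = (1/2) *\<^sub>R ((n \<bullet> x) *\<^sub>R m + (m \<bullet> x) *\<^sub>R n)" for x
    by (rule symmetric_form_vanishing_on_hyperplane[where R = R, OF _ _ n _ m_def])
      (auto simp: R_def inner_diff sym conf)
  have A: "A x = (1/2) *\<^sub>R ((n \<bullet> x) *\<^sub>R m + (m \<bullet> x) *\<^sub>R n) + r *\<^sub>R x" for x
    unfolding R[of x, symmetric] by (simp add: R_def)
  note S = symmetric_product_spectrum[OF A spec l n]
  define w where "w = m \<times> n"
  have w0: "w \<noteq> 0" using S(1) by (simp add: w_def)
  \<comment> \<open>The middle eigenvector lies in the kernel of \<open>R\<close>. Since
    \<open>m\<close> and \<open>n\<close> are independent, it is orthogonal to both, and therefore
    \<open>w\<close> is a multiple of \<open>b\<close>.\<close>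
  have "R b = 0" using b S(2) by (simp add: R_def)
  then have z: "(n \<bullet> b) *\<^sub>R m + (m \<bullet> b) *\<^sub>R n = 0" using R[of b] by simp
  then have "((n \<bullet> b) *\<^sub>R m + (m \<bullet> b) *\<^sub>R n) \<times> n = 0" by simp
  then have nb: "n \<bullet> b = 0" using w0 by (simp add: cross_add_left cross_mult_left w_def)
  then have mb: "m \<bullet> b = 0" using z n by simp
  have "b \<times> w = 0" by (simp add: w_def Lagrange nb mb inner_commute[of b])
  moreover have "b \<noteq> 0" using b by auto
  ultimately have wb: "w = (w \<bullet> b) *\<^sub>R b"
    using cross_zero_iff_parallel[of b w] b(1) cross_skew[of b w] by simp
  \<comment> \<open>This is the origin of the formula for \<open>\<mu>\<close>: the cross product
    with \<open>n\<close> discards the multiple \<open>r\<close> of \<open>n\<close> and the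
    \<open>n\<close> part of \<open>R n\<close>, so \<open>\<mu>\<close> is half the component of
    \<open>w\<close> along \<open>b\<close>.\<close>
  have "A n \<times> n = R n \<times> n" by (simp add: R_def Cross3.left_diff_distrib cross_mult_left)
  also have "\<dots> = ((n \<bullet> n) / 2) *\<^sub>R w"
    unfolding R by (simp add: cross_add_left cross_mult_left w_def)
  finally have mu: "2 * \<mu> = w \<bullet> b" using n by (simp add: \<mu> inner_commute)
  have "w \<bullet> w = (w \<bullet> b) * (w \<bullet> b)"
    using arg_cong2[OF wb wb, of inner] b(1) by simp
  then have "4 * ((l2 - l1) * (l3 - l2)) = (2 * \<mu>) * (2 * \<mu>)"
    unfolding S(3) mu w_def[symmetric] .
  then show "\<mu>\<^sup>2 = (l2 - l1) * (l3 - l2)" by (simp add: power2_eq_square)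
  have "A s - l2 *\<^sub>R s + \<mu> *\<^sub>R (s \<times> b) = (n \<bullet> s) *\<^sub>R m" for s
  proof -
    \<comment> \<open>The Lagrange identity for the cross product of \<open>s\<close> with
      \<open>w\<close> produces the antisymmetrised product of \<open>m\<close> and
      \<open>n\<close>. Added to the symmetrised one, it cancels the terms with
      \<open>m \<bullet> s\<close> and doubles those with \<open>n \<bullet> s\<close>.\<close>
    have "\<mu> *\<^sub>R (s \<times> b) = (1/2) *\<^sub>R (s \<times> ((w \<bullet> b) *\<^sub>R b))"
      unfolding mu[symmetric] by (simp add: cross_mult_right)
    also have "\<dots> = (1/2) *\<^sub>R (s \<times> w)" by (simp only: wb[symmetric])
    also have "\<dots> = (1/2) *\<^sub>R ((s \<bullet> n) *\<^sub>R m - (s \<bullet> m) *\<^sub>R n)"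
      by (simp only: w_def Lagrange)
    finally have "\<mu> *\<^sub>R (s \<times> b) = (1/2) *\<^sub>R ((s \<bullet> n) *\<^sub>R m - (s \<bullet> m) *\<^sub>R n)" .
    then show ?thesis
      unfolding A S(2) by (simp add: vec_eq_iff inner_commute[of s] field_simps)
  qed
  then show "\<exists>m. \<forall>s. A s - l2 *\<^sub>R s + \<mu> *\<^sub>R (s \<times> b) = (n \<bullet> s) *\<^sub>R m" by blast
qed

unbundle no cross3_syntax

section \<open>Orthonormal frames\<close>

locale orthonormal_frame =
  fixes M :: "('a, 3) oriented_riemannian" and U :: "'a set"
    and e :: "3 \<Rightarrow> ('a, 3) vfield" and \<omega> :: "3 \<Rightarrow> 'a \<Rightarrow> ('a, 3) tangent \<Rightarrow> real"
  assumes M: "oriented_riemannian_manifold M" and U: "openin (mtop M) U"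
    and frame: "pos_orthonormal_frame_on M U e" and coframe: "dual_coframe_on M U e \<omega>"
begin

lemma manifold: "smooth_manifold M" and riemannian: "riemannian_metric M (metric M)"
  using M by (auto simp: oriented_riemannian_manifold_def)

lemma U_mpoints: "x \<in> U \<Longrightarrow> x \<in> mpoints M"
  using U openin_subset by blast

lemma frame_tangent: "x \<in> U \<Longrightarrow> e i x \<in> tangent_space M x"
  using frame by (auto simp: pos_orthonormal_frame_on_def smooth_vfield_on_def)

lemma frame_smooth: "smooth_vfield_on M U (e i)"
  using frame by (auto simp: pos_orthonormal_frame_on_def)

lemma frame_orthonormal: "x \<in> U \<Longrightarrow> metric M x (e i x) (e j x) = (if i = j then 1 else 0)"
  using frame by (auto simp: pos_orthonormal_frame_on_def)

lemma coframe_covector: "x \<in> U \<Longrightarrow> covector M x (\<omega> i x)"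
  using coframe by (auto simp: dual_coframe_on_def)

lemma coframe_dual: "x \<in> U \<Longrightarrow> \<omega> i x (e j x) = (if i = j then 1 else 0)"
  using coframe by (auto simp: dual_coframe_on_def)

lemma metric_covector: "x \<in> U \<Longrightarrow> v \<in> tangent_space M x \<Longrightarrow> covector M x (metric M x v)"
  using riemannian U_mpoints by (auto simp: riemannian_metric_def)

lemma metric_sym:
  "x \<in> U \<Longrightarrow> v \<in> tangent_space M x \<Longrightarrow> w \<in> tangent_space M x \<Longrightarrow> metric M x v w = metric M x w v"
  using riemannian U_mpoints by (auto simp: riemannian_metric_def)

definition vec_of :: "'a \<Rightarrow> real^3 \<Rightarrow> ('a, 3) tangent" where
  "vec_of x s = (\<lambda>c. \<Sum>i\<in>UNIV. s $ i *\<^sub>R e i x c)"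

definition coords :: "'a \<Rightarrow> ('a, 3) tangent \<Rightarrow> real^3" where
  "coords x v = (\<chi> i. \<omega> i x v)"

lemma vec_of_tangent: "x \<in> U \<Longrightarrow> vec_of x s \<in> tangent_space M x"
  unfolding vec_of_def by (rule tangent_sum[OF manifold frame_tangent])

lemma coords_vec_of: "x \<in> U \<Longrightarrow> coords x (vec_of x s) = s"
  unfolding vec_of_def coords_def
  by (simp add: covector_sum[OF manifold coframe_covector frame_tangent] coframe_dual vec_eq_iff
      if_distrib[of "\<lambda>z. _ * z"] cong: if_cong)

text \<open>The frame spans: in a positive chart its component matrix has positive determinant, so
  \<open>v c\<close> is a combination of the frame, and agreement in one chart is agreement of
  tangent vectors.\<close>

lemma vec_of_coords:
  assumes x: "x \<in> U" and v: "v \<in> tangent_space M x"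
  shows "vec_of x (coords x v) = v"
proof -
  obtain c where c: "c \<in> pos_charts M" "x \<in> fst c"
    using M U_mpoints[OF x] unfolding oriented_riemannian_manifold_def orientation_def by blast
  then have c_at: "c \<in> charts_at M x"
    using M unfolding oriented_riemannian_manifold_def orientation_def charts_at_def by blast
  define B where "B = transpose (\<chi> i. e i x c)"
  have "det (\<chi> i. e i x c) > 0"
    using frame c x by (auto simp: pos_orthonormal_frame_on_def)
  then have "invertible B" by (simp add: B_def invertible_det_nz det_transpose)
  then obtain s where s: "B *v s = v c"
    by (metis invertible_def matrix_vector_mul_assoc matrix_vector_mul_lid)
  have "vec_of x s c = B *v s"
    by (simp add: vec_of_def B_def matrix_vector_mult_def transpose_def vec_eq_iff mult.commute)
  then have "vec_of x s = v"
    using tangent_eqI[OF manifold c_at vec_of_tangent[OF x] v] s by simp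
  then show ?thesis using coords_vec_of[OF x, of s] by simp
qed

text \<open>For an orthonormal frame the dual coframe is the metric dual. Together with
  \<open>metric_coords\<close> this moves all questions at a point to the Euclidean space of
  coordinate triples.\<close>

lemma metric_frame:
  assumes "x \<in> U" "v \<in> tangent_space M x"
  shows "metric M x v (e i x) = \<omega> i x v"
proof -
  have "metric M x v (e i x) = metric M x (e i x) (vec_of x (coords x v))"
    using metric_sym[OF assms(1,2) frame_tangent[OF assms(1)]] vec_of_coords[OF assms] by simp
  also have "\<dots> = \<omega> i x v"
    unfolding vec_of_def
    by (simp add: covector_sum[OF manifold metric_covector[OF _ frame_tangent] frame_tangent] assms
      frame_orthonormal coords_def if_distrib[of "\<lambda>z. _ * z"] cong: if_cong)
  finally show ?thesis .
qed

lemma metric_coords: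
  assumes "x \<in> U" "v \<in> tangent_space M x" "w \<in> tangent_space M x"
  shows "metric M x v w = coords x v \<bullet> coords x w"
proof -
  have "metric M x v w = metric M x v (vec_of x (coords x w))"
    by (simp only: vec_of_coords[OF assms(1,3)])
  also have "\<dots> = coords x v \<bullet> coords x w"
    unfolding vec_of_def
    by (simp add: covector_sum[OF manifold metric_covector frame_tangent] assms
      metric_frame coords_def inner_vec_def mult.commute)
  finally show ?thesis .
qed

lemma coords_inj:
  "x \<in> U \<Longrightarrow> v \<in> tangent_space M x \<Longrightarrow> w \<in> tangent_space M x \<Longrightarrow> coords x v = coords x w \<Longrightarrow> v = w"
  using vec_of_coords by metis

lemma coords_scale:
  assumes "x \<in> U" "v \<in> tangent_space M x" shows "coords x (\<lambda>c. l *\<^sub>R v c) = l *\<^sub>R coords x v"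
proof -
  have "\<omega> i x (\<lambda>c. \<Sum>j\<in>{()}. l *\<^sub>R v c) = (\<Sum>j\<in>{()}. l * \<omega> i x v)" for i
    by (rule covector_sum[OF manifold coframe_covector[OF assms(1)]]) (rule assms(2))
  then show ?thesis by (simp add: coords_def vec_eq_iff)
qed

lemma coords_zero: "x \<in> U \<Longrightarrow> coords x (\<lambda>_. 0) = 0"
  by (simp add: coords_def vec_eq_iff covector_zero[OF manifold coframe_covector])

lemma vec_of_0: "vec_of x 0 = (\<lambda>_. 0)"
  by (simp add: vec_of_def)

lemma vec_of_scale: "vec_of x (l *\<^sub>R s) = (\<lambda>c. l *\<^sub>R vec_of x s c)"
  by (simp add: vec_of_def scaleR_sum_right)

text \<open>The coefficients of the differential of the third chart function in the coframe.\<close>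

definition conormal :: "('a, 3) chart \<Rightarrow> 'a \<Rightarrow> real^3" where
  "conormal c x = (\<chi> j. e j x c $ 3)"

lemma conormal_vec_of: "vec_of x s c $ 3 = conormal c x \<bullet> s"
  by (simp add: conormal_def vec_of_def inner_vec_def mult.commute)

text \<open>The third coordinate vector of the chart has third component 1, but a zero conormal
  would give it third component 0.\<close>

lemma conormal_nonzero:
  assumes "x \<in> U" "c \<in> charts_at M x"
  shows "conormal c x \<noteq> 0"
proof
  assume 0: "conormal c x = 0"
  let ?v = "tangent_of M c x (axis 3 1)"
  have "vec_of x (coords x ?v) c $ 3 = ?v c $ 3"
    using vec_of_coords[OF assms(1) tangent_of_in_tangent_space[OF manifold assms(2)]] by simp
  then show False
    using 0 tangent_of_self[OF manifold assms(2), of "axis 3 1"] by (simp add: conormal_vec_of)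
qed

section \<open>Derivatives of functions along the frame, in a fixed chart\<close>

definition smooth_fn_at :: "('a, 3) chart \<Rightarrow> 'a \<Rightarrow> ('a \<Rightarrow> real) \<Rightarrow> bool" where
  "smooth_fn_at c x f \<longleftrightarrow> smooth_at (\<lambda>p. f (cinv c p)) (snd c x)"

text \<open>The chart is an explicit argument so that all product and sum rules are computed in one
  foliated chart; \<open>differential_frame\<close> links the result with the chart independent
  \<open>differential\<close>.\<close>

definition frame_deriv :: "('a, 3) chart \<Rightarrow> 'a \<Rightarrow> ('a \<Rightarrow> real) \<Rightarrow> 3 \<Rightarrow> real" where
  "frame_deriv c x f k = frechet_derivative (\<lambda>p. f (cinv c p)) (at (snd c x)) (e k x c)"

lemma smooth_fn_at_cong:
  assumes "x \<in> W" "openin (mtop M) W" "\<And>y. y \<in> W \<Longrightarrow> f y = g y" "c \<in> charts_at M x"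
    "smooth_fn_at c x f"
  shows "smooth_fn_at c x g"
  unfolding smooth_fn_at_def
  by (rule smooth_at_cong[OF assms(5)[unfolded smooth_fn_at_def]
        eventually_mono[OF eventually_chart[OF manifold assms(4,2,1)]]])
    (simp add: assms(3))

lemma frame_deriv_cong:
  assumes "x \<in> W" "openin (mtop M) W" "\<And>y. y \<in> W \<Longrightarrow> f y = g y" "c \<in> charts_at M x"
  shows "frame_deriv c x f k = frame_deriv c x g k"
proof -
  have "eventually (\<lambda>p. f (cinv c p) = g (cinv c p)) (nhds (snd c x))"
    by (rule eventually_mono[OF eventually_chart[OF manifold assms(4,2,1)]]) (simp add: assms(3))
  from frechet_derivative_cong_eventually[OF this] show ?thesis by (simp add: frame_deriv_def)
qed

lemma smooth_fn_at_algebra: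
  assumes "smooth_fn_at c x f" "smooth_fn_at c x g"
  shows "smooth_fn_at c x (\<lambda>y. f y + g y)" "smooth_fn_at c x (\<lambda>y. f y - g y)"
    "smooth_fn_at c x (\<lambda>y. f y * g y)"
  using assms unfolding smooth_fn_at_def
  by (auto intro: smooth_at_add smooth_at_diff smooth_at_mult)

lemma smooth_fn_at_divide:
  assumes "smooth_fn_at c x f" "smooth_fn_at c x g" "g x \<noteq> 0" "c \<in> charts_at M x"
  shows "smooth_fn_at c x (\<lambda>y. f y / g y)"
  using assms unfolding smooth_fn_at_def
  by (intro smooth_at_divide) (auto simp: cinv_left[OF manifold] charts_at_def)

lemma smooth_fn_at_sum:
  "(\<And>i. i \<in> A \<Longrightarrow> smooth_fn_at c x (f i)) \<Longrightarrow> smooth_fn_at c x (\<lambda>y. \<Sum>i\<in>A. f i y)"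
  unfolding smooth_fn_at_def by (rule smooth_at_sum)

lemma smooth_fn_has_derivative:
  "smooth_fn_at c x f \<Longrightarrow>
    ((\<lambda>p. f (cinv c p)) has_derivative frechet_derivative (\<lambda>p. f (cinv c p)) (at (snd c x))) (at (snd c x))"
  unfolding smooth_fn_at_def using smooth_at_imp_differentiable frechet_derivative_works by blast

lemma frame_deriv_algebra:
  assumes f: "smooth_fn_at c x f" and g: "smooth_fn_at c x g" and c: "c \<in> charts_at M x"
  shows "frame_deriv c x (\<lambda>y. f y + g y) k = frame_deriv c x f k + frame_deriv c x g k"
    "frame_deriv c x (\<lambda>y. f y - g y) k = frame_deriv c x f k - frame_deriv c x g k"
    "frame_deriv c x (\<lambda>y. f y * g y) k = f x * frame_deriv c x g k + frame_deriv c x f k * g x"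
  using frechet_derivative_at[OF has_derivative_add[OF f[THEN smooth_fn_has_derivative] g[THEN smooth_fn_has_derivative]], symmetric]
    frechet_derivative_at[OF has_derivative_diff[OF f[THEN smooth_fn_has_derivative] g[THEN smooth_fn_has_derivative]], symmetric]
    frechet_derivative_at[OF has_derivative_mult[OF f[THEN smooth_fn_has_derivative] g[THEN smooth_fn_has_derivative]], symmetric]
    c
  by (simp_all add: frame_deriv_def charts_at_def cinv_left[OF manifold])

lemma differential_frame:
  assumes "smooth_fn_at c x f" "c \<in> charts_at M x" "x \<in> U"
  shows "differential M f x (e k x) = frame_deriv c x f k"
  using differential_eq[OF manifold assms(2) _ frame_tangent[OF assms(3)], of f k]
    assms(1) smooth_at_imp_differentiable unfolding smooth_fn_at_def frame_deriv_def comp_def by blast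

lemma differential_expand:
  assumes f: "smooth_fn_at c x f" and c: "c \<in> charts_at M x" and x: "x \<in> U" and v: "v \<in> tangent_space M x"
  shows "differential M f x v = (\<Sum>k\<in>UNIV. differential M f x (e k x) * \<omega> k x v)"
proof -
  let ?D = "frechet_derivative (\<lambda>p. f (cinv c p)) (at (snd c x))"
  have lin: "linear ?D" using smooth_fn_has_derivative[OF f] has_derivative_linear by blast
  have "differential M f x v = ?D (v c)"
    using differential_eq[OF manifold c _ v, of f]
      f smooth_at_imp_differentiable unfolding smooth_fn_at_def comp_def by blast
  also have "v c = (\<Sum>k\<in>UNIV. \<omega> k x v *\<^sub>R e k x c)"
    using arg_cong[OF vec_of_coords[OF x v], of "\<lambda>v. v c"] by (simp add: vec_of_def coords_def)
  also have "?D \<dots> = (\<Sum>k\<in>UNIV. \<omega> k x v * ?D (e k x c))"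
    by (simp add: linear_sum[OF lin] linear_scale[OF lin])
  finally show ?thesis
    using differential_frame[OF f c x] by (simp add: frame_deriv_def mult.commute)
qed

lemma conormal_smooth:
  assumes "x \<in> U" "c \<in> charts_at M x"
  shows "smooth_fn_at c x (\<lambda>y. conormal c y $ j)"
  using smooth_at_vec_nth[OF smooth_vfield_at[OF manifold frame_smooth U assms]]
  by (simp add: smooth_fn_at_def conormal_def)

text \<open>This is \<open>d(dx\<^sub>3) = 0\<close> evaluated on \<open>e\<^sub>j, e\<^sub>k\<close>, where \<open>x\<^sub>3\<close> is the third chart function.\<close>

lemma conormal_closed:
  assumes x: "x \<in> U" and c: "c \<in> charts_at M x"
    and br: "lie_bracket M (e j) (e k) x = (\<lambda>c. \<Sum>i\<in>UNIV. C i *\<^sub>R e i x c)"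
  shows "frame_deriv c x (\<lambda>y. conormal c y $ k) j - frame_deriv c x (\<lambda>y. conormal c y $ j) k
    = (\<Sum>i\<in>UNIV. C i * conormal c x $ i)"
proof -
  have D: "frechet_derivative (\<lambda>p. e i (cinv c p) c $ 3) (at (snd c x)) v =
      frechet_derivative (\<lambda>p. e i (cinv c p) c) (at (snd c x)) v $ 3" for i v
  proof -
    have "(\<lambda>p. e i (cinv c p) c) differentiable (at (snd c x))"
      by (intro smooth_at_imp_differentiable smooth_vfield_at[OF manifold frame_smooth U x c])
    then have "((\<lambda>p. e i (cinv c p) c) has_derivative
        frechet_derivative (\<lambda>p. e i (cinv c p) c) (at (snd c x))) (at (snd c x))"
      using frechet_derivative_works by blast
    from frechet_derivative_at[OF bounded_linear.has_derivative[OF bounded_linear_vec_nth this, of 3]]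
    show ?thesis by metis
  qed
  \<comment> \<open>In coordinates, the third component of the bracket is the derivative of the k-th
    conormal coefficient along \<open>e j\<close> minus that of the j-th along
    \<open>e k\<close>.\<close>
  have "lie_bracket M (e j) (e k) x c $ 3 = (\<Sum>i\<in>UNIV. C i * conormal c x $ i)"
    unfolding br by (simp add: conormal_def)
  then show ?thesis using c by (simp add: lie_bracket_def frame_deriv_def conormal_def D)
qed

text \<open>The condition \<open>\<theta> \<and> d\<theta> = 0\<close> evaluated on the frame, for the one-form \<open>\<theta>\<close> with coefficients
  \<open>t\<close>, a multiple of the differential of the third chart function.\<close>

lemma frobenius:
  fixes t :: "3 \<Rightarrow> 'a \<Rightarrow> real"
  assumes x: "x \<in> U" and c: "c \<in> charts_at M x"
    and W: "x \<in> W" "openin (mtop M) W"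
    and t: "\<And>j. smooth_fn_at c x (t j)"
    and tm: "\<And>y. y \<in> W \<Longrightarrow> \<exists>m. \<forall>j. t j y = m * conormal c y $ j"
    and br: "\<And>j k. lie_bracket M (e j) (e k) x = (\<lambda>c. \<Sum>i\<in>UNIV. C i j k *\<^sub>R e i x c)"
  shows "(frame_deriv c x (t 2) 1 - frame_deriv c x (t 1) 2 - (\<Sum>i\<in>UNIV. C i 1 2 * t i x)) * t 3 x
    - (frame_deriv c x (t 3) 1 - frame_deriv c x (t 1) 3 - (\<Sum>i\<in>UNIV. C i 1 3 * t i x)) * t 2 x
    + (frame_deriv c x (t 3) 2 - frame_deriv c x (t 2) 3 - (\<Sum>i\<in>UNIV. C i 2 3 * t i x)) * t 1 x = 0"
proof -
  define n where "n j y = conormal c y $ j" for j y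
  \<comment> \<open>The hypothesis gives a factor at each point without any regularity. Since the
    conormal does not vanish, this quotient is the same factor as a smooth function.\<close>
  define m where "m y = (\<Sum>j\<in>UNIV. t j y * n j y) / (\<Sum>j\<in>UNIV. n j y * n j y)" for y
  have n: "smooth_fn_at c x (n j)" for j
    using conormal_smooth[OF x c] by (simp add: n_def[abs_def])
  have nn: "(\<Sum>j\<in>UNIV. n j y * n j y) \<noteq> 0" if "y \<in> U" "c \<in> charts_at M y" for y
  proof -
    have "(\<Sum>j\<in>UNIV. n j y * n j y) = conormal c y \<bullet> conormal c y"
      by (simp add: n_def inner_vec_def)
    then show ?thesis using conormal_nonzero[OF that] by simp
  qed
  have m: "smooth_fn_at c x m"
    unfolding m_def[abs_def]
    by (intro smooth_fn_at_divide smooth_fn_at_sum smooth_fn_at_algebra t n nn x c)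
  have eq: "t j y = m y * n j y" if y: "y \<in> (W \<inter> U) \<inter> fst c" for j y
  proof -
    obtain l where l: "\<And>j. t j y = l * n j y" using tm y unfolding n_def by blast
    have "c \<in> charts_at M y" using y c by (simp add: charts_at_def)
    then have "m y = l" using nn[of y] y unfolding m_def l by (simp add: mult.assoc flip: sum_distrib_left)
    then show ?thesis by (simp add: l)
  qed
  have xW: "x \<in> (W \<inter> U) \<inter> fst c" using x c W by (simp add: charts_at_def)
  have oW: "openin (mtop M) ((W \<inter> U) \<inter> fst c)"
    using W U chart_openin[OF manifold, of c] c by (intro openin_Int) (auto simp: charts_at_def)
  have D: "frame_deriv c x (t j) k = m x * frame_deriv c x (n j) k + frame_deriv c x m k * n j x" for j k
    using frame_deriv_cong[OF xW oW eq c] frame_deriv_algebra(3)[OF m n c] by simp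
  have T: "t j x = m x * n j x" for j by (rule eq[OF xW])
  have cl: "frame_deriv c x (n k) j = frame_deriv c x (n j) k + (\<Sum>i\<in>UNIV. C i j k * n i x)" for j k
    using conormal_closed[OF x c br, of k j] by (simp add: n_def[abs_def] algebra_simps)
  \<comment> \<open>Closedness of the conormal replaces the antisymmetrised derivatives of
    \<open>n\<close> by structure terms that cancel the sums with \<open>C\<close>. The terms with
    derivatives of \<open>m\<close> contain the conormal twice and cancel by antisymmetry.\<close>
  show ?thesis
    unfolding D T cl[of 2 1] cl[of 3 1] cl[of 3 2] sum_3 by (simp add: algebra_simps)
qed

text \<open>The Frobenius condition in the shape of the final identities: \<open>p\<close>,
  \<open>q\<close>, \<open>r\<close> are the three coefficients of a row, and \<open>d12\<close>,
  \<open>d13\<close>, \<open>d23\<close> are left free so that expanded derivatives in any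
  arrangement can be matched with them.\<close>

lemma frobenius3:
  fixes p q r :: "'a \<Rightarrow> real"
  assumes "x \<in> U" "c \<in> charts_at M x" "x \<in> W" "openin (mtop M) W"
    and f: "smooth_fn_at c x p" "smooth_fn_at c x q" "smooth_fn_at c x r"
    and m: "\<And>y. y \<in> W \<Longrightarrow> \<exists>m. p y = m * conormal c y $ 1 \<and> q y = m * conormal c y $ 2 \<and>
        r y = m * conormal c y $ 3"
    and "\<And>j k. lie_bracket M (e j) (e k) x = (\<lambda>c. \<Sum>i\<in>UNIV. C i j k *\<^sub>R e i x c)"
    and d: "frame_deriv c x q 1 - frame_deriv c x p 2 = d12"
      "frame_deriv c x r 1 - frame_deriv c x p 3 = d13"
      "frame_deriv c x r 2 - frame_deriv c x q 3 = d23"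
  shows "0 = (d12
      - p x * C 1 1 2 - q x * C 2 1 2 - r x * C 3 1 2) * r x
    - (d13
      - p x * C 1 1 3 - q x * C 2 1 3 - r x * C 3 1 3) * q x
    + (d23
      - p x * C 1 2 3 - q x * C 2 2 3 - r x * C 3 2 3) * p x"
proof -
  define t :: "3 \<Rightarrow> 'a \<Rightarrow> real" where "t j = (if j = 1 then p else if j = 2 then q else r)" for j
  have t: "t 1 = p" "t 2 = q" "t 3 = r" by (simp_all add: t_def)
  have "smooth_fn_at c x (t j)" for j using f by (simp add: t_def)
  moreover have "\<exists>m. \<forall>j. t j y = m * conormal c y $ j" if "y \<in> W" for y
    using m[OF that] by (simp add: forall_3 t)
  ultimately show ?thesis
    using frobenius[of x c W t C] assms(1-4,9) unfolding t sum_3 d by (simp add: mult.commute diff_diff_eq add.assoc)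
qed

end

text \<open>Starting at \<open>x\<close>, a straight line in the chart \<open>c\<close> with
  direction \<open>v c\<close> stays on one plaque of \<open>c\<close>, hence near \<open>x\<close>
  on one plaque of \<open>d\<close>. The third coordinate of \<open>d\<close> is constant along it,
  so its derivative, the third component of \<open>v d\<close>, vanishes.\<close>

lemma foliated_charts_conormal:
  fixes M :: "('a, 3, 'm) manifold_scheme"
  assumes M: "smooth_manifold M" and F: "foliated_atlas M U F"
    and c: "c \<in> F" "x \<in> fst c" and d: "d \<in> F" "x \<in> fst d"
    and v: "v \<in> tangent_space M x" "v c $ 3 = 0"
  shows "v d $ 3 = 0"
proof -
  have ch: "c \<in> charts_at M x" "d \<in> charts_at M x"
    using F c d by (auto simp: foliated_atlas_def charts_at_def)
  have "\<forall>c\<in>F. \<forall>d\<in>F. \<forall>x\<in>fst c \<inter> fst d. \<exists>W. openin (mtop M) W \<and> x \<in> W \<and> W \<subseteq> fst c \<inter> fst d \<and>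
      (\<forall>p\<in>W. \<forall>q\<in>W. snd c p $ 3 = snd c q $ 3 \<longleftrightarrow> snd d p $ 3 = snd d q $ 3)"
    using F unfolding foliated_atlas_def by (elim conjE)
  from this[rule_format, OF c(1) d(1) IntI[OF c(2) d(2)]]
  obtain W where W: "openin (mtop M) W" "x \<in> W"
    "\<And>p q. p \<in> W \<Longrightarrow> q \<in> W \<Longrightarrow> snd c p $ 3 = snd c q $ 3 \<longleftrightarrow> snd d p $ 3 = snd d q $ 3"
    by (elim exE conjE) metis
  let ?D = "frechet_derivative (transition c d) (at (snd c x))"
  define \<tau> where "\<tau> s = transition c d (snd c x + s *\<^sub>R v c) $ 3" for s
  have "((\<lambda>s. snd c x + s *\<^sub>R v c) has_derivative (\<lambda>s. s *\<^sub>R v c)) (at 0)"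
    by (auto intro!: derivative_eq_intros)
  then have "(transition c d \<circ> (\<lambda>s. snd c x + s *\<^sub>R v c) has_derivative ?D \<circ> (\<lambda>s. s *\<^sub>R v c)) (at 0)"
    by (rule diff_chain_at) (use transition_differentiable[OF M ch] in simp)
  from bounded_linear.has_derivative[OF bounded_linear_vec_nth this, of 3]
  have 1: "(\<tau> has_derivative (\<lambda>s. ?D (s *\<^sub>R v c) $ 3)) (at 0)"
    unfolding \<tau>_def[abs_def] comp_def .
  have "((\<lambda>s. snd c x + s *\<^sub>R v c) \<longlongrightarrow> snd c x + 0 *\<^sub>R v c) (nhds 0)"
    by (intro tendsto_intros filterlim_ident)
  then have "filterlim (\<lambda>s. snd c x + s *\<^sub>R v c) (nhds (snd c x)) (nhds (0::real))" by simp
  from eventually_compose_filterlim[OF eventually_chart[OF M ch(1) W(1,2)] this]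
  have "eventually (\<lambda>s. \<tau> s = snd d x $ 3) (nhds 0)"
  proof eventually_elim
    case (elim s)
    then show ?case
      using W(3)[of "cinv c (snd c x + s *\<^sub>R v c)" x] W(2) v(2) by (simp add: \<tau>_def transition_def)
  qed
  then have "(\<tau> has_derivative (\<lambda>_. 0)) (at 0)"
    using has_derivative_cong_eventually[of \<tau> "\<lambda>_. snd d x $ 3" 0] by simp
  from fun_cong[OF has_derivative_unique[OF 1 this], of 1] have "?D (v c) $ 3 = 0" by simp
  moreover have "v d = ?D (v c)" using v(1) ch unfolding tangent_space_def by blast
  ultimately show ?thesis by simp
qed

section \<open>Leafwise conformal diffeomorphisms\<close>

locale conformal_foliation = orthonormal_frame M U e \<omega>
  for M :: "('a, 3) oriented_riemannian" and U e \<omega> +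
  fixes N :: "('b, 3) oriented_riemannian" and \<phi> :: "'a \<Rightarrow> 'b"
    and lam1 lam2 lam3 :: "'a \<Rightarrow> real" and \<xi>2 :: "('a, 3) vfield"
    and a :: "3 \<Rightarrow> 3 \<Rightarrow> 'a \<Rightarrow> real" and \<beta> :: "3 \<Rightarrow> 'a \<Rightarrow> real" and F :: "('a, 3) chart set"
  assumes N: "oriented_riemannian_manifold N" and diffeo: "diffeomorphism M N \<phi>"
    and spectrum: "x \<in> U \<Longrightarrow> lam1 x < lam2 x \<and> lam2 x < lam3 x \<and>
           eigenvalues_at M x (S_endo M N \<phi> x) = {lam1 x, lam2 x, lam3 x}"
    and xi_smooth: "smooth_vfield_on M U \<xi>2"
    and xi: "x \<in> U \<Longrightarrow> metric M x (\<xi>2 x) (\<xi>2 x) = 1 \<and>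
           eigenvector_at M x (S_endo M N \<phi> x) (lam2 x) (\<xi>2 x)"
    and a: "x \<in> U \<Longrightarrow> v \<in> tangent_space M x \<Longrightarrow>
           \<omega> i x (S_endo M N \<phi> x v) = (\<Sum>j\<in>UNIV. a i j x * \<omega> j x v)"
    and \<beta>: "x \<in> U \<Longrightarrow> v \<in> tangent_space M x \<Longrightarrow>
           metric M x (\<xi>2 x) v = (\<Sum>i\<in>UNIV. \<beta> i x * \<omega> i x v)"
    and foliated: "foliated_atlas M U F"
    and conformal: "L \<in> leaves U F \<Longrightarrow> conformal_on_leaf M N \<phi> F L"
begin

lemma manifold_N: "smooth_manifold N" and riemannian_N: "riemannian_metric N (metric N)"
  using N by (auto simp: oriented_riemannian_manifold_def)

lemma smooth_phi: "smooth_map M N \<phi>"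
  using diffeo by (auto simp: diffeomorphism_def)

lemma phi_mpoints: "x \<in> U \<Longrightarrow> \<phi> x \<in> mpoints N"
  using U_mpoints diffeo by (auto simp: diffeomorphism_def bij_betw_def)

section \<open>The adjoint and the matrix of \<open>S\<close> in the frame\<close>

abbreviation "push \<equiv> pushforward M N \<phi>"

lemma push_tangent: "x \<in> U \<Longrightarrow> v \<in> tangent_space M x \<Longrightarrow> push x v \<in> tangent_space N (\<phi> x)"
  by (rule pushforward_in_tangent_space[OF manifold manifold_N smooth_phi U_mpoints])

text \<open>The adjoint is a definite description, so unique existence is required. The vector with
  frame components \<open>metric N (\<phi> x) w (push x (e i x))\<close> has the adjoint property,
  and testing on the frame shows that it is the only one.\<close>

lemma adjoint_spec:
  assumes x: "x \<in> U" and w: "w \<in> tangent_space N (\<phi> x)"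
  shows "pushforward_adjoint M N \<phi> x w \<in> tangent_space M x"
    and "u \<in> tangent_space M x \<Longrightarrow>
      metric M x (pushforward_adjoint M N \<phi> x w) u = metric N (\<phi> x) w (push x u)"
proof -
  define P where "P v \<longleftrightarrow> v \<in> tangent_space M x \<and>
     (\<forall>u\<in>tangent_space M x. metric M x v u = metric N (\<phi> x) w (push x u))" for v
  define s where "s = (\<chi> i. metric N (\<phi> x) w (push x (e i x)))"
  have cov: "covector N (\<phi> x) (metric N (\<phi> x) w)"
    using riemannian_N phi_mpoints[OF x] w by (auto simp: riemannian_metric_def)
  have "P (vec_of x s)" unfolding P_def
  proof (intro conjI ballI vec_of_tangent x)
    fix u assume u: "u \<in> tangent_space M x"
    have "push x u = push x (vec_of x (coords x u))" by (simp only: vec_of_coords[OF x u])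
    also have "\<dots> = (\<lambda>d. \<Sum>i\<in>UNIV. coords x u $ i *\<^sub>R push x (e i x) d)"
      unfolding vec_of_def
      by (rule pushforward_sum[OF manifold manifold_N smooth_phi U_mpoints[OF x] frame_tangent[OF x]])
    finally have "metric N (\<phi> x) w (push x u) = (\<Sum>i\<in>UNIV. coords x u $ i * s $ i)"
      by (simp add: covector_sum[OF manifold_N cov push_tangent[OF x frame_tangent[OF x]]] s_def)
    then show "metric M x (vec_of x s) u = metric N (\<phi> x) w (push x u)"
      by (simp add: metric_coords[OF x vec_of_tangent[OF x] u] coords_vec_of[OF x] inner_vec_def mult.commute)
  qed
  moreover have "v = vec_of x s" if "P v" for v
  proof (rule coords_inj[OF x _ vec_of_tangent[OF x]])
    show v: "v \<in> tangent_space M x" using that by (simp add: P_def)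
    have "\<omega> i x v = s $ i" for i
      using that metric_frame[OF x v, of i] frame_tangent[OF x, of i] by (simp add: P_def s_def)
    then show "coords x v = coords x (vec_of x s)"
      by (simp add: coords_vec_of[OF x]) (simp add: coords_def vec_eq_iff)
  qed
  ultimately have "P (THE v. P v)" by (rule theI)
  then have "P (pushforward_adjoint M N \<phi> x w)"
    unfolding pushforward_adjoint_def P_def .
  then show "pushforward_adjoint M N \<phi> x w \<in> tangent_space M x"
    and "u \<in> tangent_space M x \<Longrightarrow>
      metric M x (pushforward_adjoint M N \<phi> x w) u = metric N (\<phi> x) w (push x u)"
    by (auto simp: P_def)
qed

abbreviation "S \<equiv> S_endo M N \<phi>"

lemma S_tangent: "x \<in> U \<Longrightarrow> v \<in> tangent_space M x \<Longrightarrow> S x v \<in> tangent_space M x"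
  unfolding S_endo_def by (intro adjoint_spec push_tangent)

lemma S_metric: "x \<in> U \<Longrightarrow> v \<in> tangent_space M x \<Longrightarrow> u \<in> tangent_space M x \<Longrightarrow>
    metric M x (S x v) u = metric N (\<phi> x) (push x v) (push x u)"
  unfolding S_endo_def by (intro adjoint_spec push_tangent)

text \<open>The coefficients are those of the pulled back metric. Both the symmetry and the
  smoothness of \<open>a\<close> come from this formula.\<close>

lemma a_eq:
  assumes x: "x \<in> U"
  shows "a i j x = metric N (\<phi> x) (push x (e j x)) (push x (e i x))"
proof -
  have "a i j x = \<omega> i x (S x (e j x))"
    by (simp add: a[OF x frame_tangent[OF x]] coframe_dual[OF x] if_distrib[of "\<lambda>z. _ * z"] cong: if_cong)
  also have "\<dots> = metric M x (S x (e j x)) (e i x)"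
    by (simp add: metric_frame x S_tangent frame_tangent)
  finally show ?thesis by (simp add: S_metric x frame_tangent)
qed

lemma a_sym: "x \<in> U \<Longrightarrow> a i j x = a j i x"
  using riemannian_N phi_mpoints push_tangent[OF _ frame_tangent]
  by (auto simp: a_eq riemannian_metric_def)

definition A :: "'a \<Rightarrow> real^3^3" where "A x = (\<chi> i j. a i j x)"

definition b :: "'a \<Rightarrow> real^3" where "b x = (\<chi> i. \<beta> i x)"

lemma coords_S: "x \<in> U \<Longrightarrow> v \<in> tangent_space M x \<Longrightarrow> coords x (S x v) = A x *v coords x v"
  by (simp add: coords_def A_def matrix_vector_mult_def vec_eq_iff a)

lemma A_sym: "x \<in> U \<Longrightarrow> (A x *v s) \<bullet> t = s \<bullet> (A x *v t)"
  by (subst dot_lmul_matrix[symmetric])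
    (simp add: A_def vector_matrix_mult_def matrix_vector_mult_def a_sym[of x] vec_eq_iff mult.commute)

lemma xi_tangent: "x \<in> U \<Longrightarrow> \<xi>2 x \<in> tangent_space M x"
  using xi_smooth by (auto simp: smooth_vfield_on_def)

lemma \<beta>_eq: "x \<in> U \<Longrightarrow> \<beta> j x = metric M x (\<xi>2 x) (e j x)"
  by (simp add: \<beta> frame_tangent coframe_dual if_distrib[of "\<lambda>z. _ * z"] cong: if_cong)

lemma coords_xi: "x \<in> U \<Longrightarrow> coords x (\<xi>2 x) = b x"
  by (simp add: coords_def b_def vec_eq_iff \<beta>_eq metric_frame xi_tangent)

lemma b_unit: "x \<in> U \<Longrightarrow> b x \<bullet> b x = 1"
  using xi metric_coords[OF _ xi_tangent xi_tangent] by (simp add: coords_xi)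

lemma A_b:
  assumes x: "x \<in> U" shows "A x *v b x = lam2 x *\<^sub>R b x"
proof -
  have "S x (\<xi>2 x) = (\<lambda>c. lam2 x *\<^sub>R \<xi>2 x c)" using xi[OF x] by (simp add: eigenvector_at_def)
  then show ?thesis
    using coords_S[OF x xi_tangent[OF x]] coords_scale[OF x xi_tangent[OF x]] by (simp add: coords_xi[OF x])
qed

lemma A_spectrum:
  assumes x: "x \<in> U"
  shows "{l. \<exists>v. v \<noteq> 0 \<and> A x *v v = l *\<^sub>R v} = {lam1 x, lam2 x, lam3 x}"
proof -
  have "(\<exists>v. v \<noteq> 0 \<and> A x *v v = l *\<^sub>R v) \<longleftrightarrow> l \<in> eigenvalues_at M x (S x)" for l
  proof
    assume "\<exists>s. s \<noteq> 0 \<and> A x *v s = l *\<^sub>R s"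
    then obtain s where s: "s \<noteq> 0" "A x *v s = l *\<^sub>R s" by blast
    have "eigenvector_at M x (S x) l (vec_of x s)"
      unfolding eigenvector_at_def
    proof (intro conjI vec_of_tangent x)
      show "vec_of x s \<noteq> (\<lambda>_. 0)" using s(1) coords_vec_of[OF x, of s] coords_zero[OF x] by auto
      have "coords x (S x (vec_of x s)) = coords x (vec_of x (l *\<^sub>R s))"
        by (simp add: coords_S x vec_of_tangent coords_vec_of s)
      then have "S x (vec_of x s) = vec_of x (l *\<^sub>R s)"
        by (rule coords_inj[OF x S_tangent[OF x vec_of_tangent[OF x]] vec_of_tangent[OF x]])
      then show "S x (vec_of x s) = (\<lambda>c. l *\<^sub>R vec_of x s c)" by (simp only: vec_of_scale)
    qed
    then show "l \<in> eigenvalues_at M x (S x)" by (auto simp: eigenvalues_at_def)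
  next
    assume "l \<in> eigenvalues_at M x (S x)"
    then obtain v where v: "v \<in> tangent_space M x" "v \<noteq> (\<lambda>_. 0)" "S x v = (\<lambda>c. l *\<^sub>R v c)"
      by (auto simp: eigenvalues_at_def eigenvector_at_def)
    have "coords x v \<noteq> 0" using v(2) vec_of_coords[OF x v(1)] vec_of_0 by metis
    moreover have "A x *v coords x v = l *\<^sub>R coords x v"
      using coords_S[OF x v(1)] coords_scale[OF x v(1)] v(3) by simp
    ultimately show "\<exists>v. v \<noteq> 0 \<and> A x *v v = l *\<^sub>R v" by blast
  qed
  then show ?thesis using spectrum[OF x] by auto
qed

text \<open>By \<open>a_eq\<close> the coefficient is the metric of \<open>N\<close> evaluated along
  \<open>\<phi>\<close> on push-forwards of the smooth frame fields.\<close>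

lemma a_smooth:
  assumes x: "x \<in> U" and c: "c \<in> charts_at M x"
  shows "smooth_fn_at c x (a i j)"
proof -
  obtain d where d: "d \<in> charts_at N (\<phi> x)"
    using charts_at_nonempty[OF manifold_N phi_mpoints[OF x]] by blast
  have cx: "cinv c (snd c x) = x" using c by (simp add: charts_at_def cinv_left[OF manifold])
  have ev: "eventually (\<lambda>p. cinv c p \<in> U) (nhds (snd c x))"
    by (rule eventually_mono[OF eventually_chart[OF manifold c U x]]) simp
  have "smooth_at (\<lambda>p. metric N (\<phi> (cinv c p)) (push (cinv c p) (e j (cinv c p)))
      (push (cinv c p) (e i (cinv c p)))) (snd c x)"
  proof (rule smooth_metric_along[OF manifold_N riemannian_N, where d = d])
    show "smooth_at (\<lambda>q. snd d (\<phi> (cinv c q))) (snd c x)"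
      using smooth_map_smooth_at[OF manifold manifold_N smooth_phi c d] by (simp add: comp_def)
    show "eventually (\<lambda>p. d \<in> charts_at N (\<phi> (cinv c p)) \<and>
        push (cinv c p) (e j (cinv c p)) \<in> tangent_space N (\<phi> (cinv c p)) \<and>
        push (cinv c p) (e i (cinv c p)) \<in> tangent_space N (\<phi> (cinv c p))) (nhds (snd c x))"
      using ev smooth_map_eventually[OF manifold manifold_N smooth_phi c d]
      by eventually_elim (simp add: push_tangent frame_tangent)
  qed (use d cx smooth_pushforward_at[OF manifold manifold_N smooth_phi frame_smooth U x c d] in simp_all)
  then show ?thesis unfolding smooth_fn_at_def
    by (rule smooth_at_cong) (use ev in eventually_elim, simp add: a_eq)
qed

lemma \<beta>_smooth:
  assumes x: "x \<in> U" and c: "c \<in> charts_at M x"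
  shows "smooth_fn_at c x (\<beta> i)"
proof -
  have cx: "cinv c (snd c x) = x" using c by (simp add: charts_at_def cinv_left[OF manifold])
  have ev: "eventually (\<lambda>p. cinv c p \<in> U \<and> c \<in> charts_at M (cinv c p)) (nhds (snd c x))"
    by (rule eventually_mono[OF eventually_chart[OF manifold c U x]])
      (use c in \<open>simp add: charts_at_def\<close>)
  have "smooth_at (\<lambda>p. metric M (cinv c p) (\<xi>2 (cinv c p)) (e i (cinv c p))) (snd c x)"
  proof (rule smooth_metric_along[OF manifold riemannian, where d = c])
    show "smooth_at (\<lambda>q. snd c (cinv c q)) (snd c x)"
      using transition_smooth[OF manifold c c] by (simp add: transition_def comp_def)
    show "eventually (\<lambda>p. c \<in> charts_at M (cinv c p) \<and>
        \<xi>2 (cinv c p) \<in> tangent_space M (cinv c p) \<and>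
        e i (cinv c p) \<in> tangent_space M (cinv c p)) (nhds (snd c x))"
      using ev by eventually_elim (simp add: xi_tangent frame_tangent)
  qed (use c cx smooth_vfield_at[OF manifold _ U x c] frame_smooth xi_smooth in simp_all)
  then show ?thesis unfolding smooth_fn_at_def
    by (rule smooth_at_cong) (use ev in eventually_elim, simp add: \<beta>_eq)
qed

text \<open>No perturbation theory of eigenvalues enters: the smooth unit eigenvector
  \<open>b\<close> gives the eigenvalue as the value of the quadratic form of \<open>A\<close> on
  \<open>b\<close>.\<close>

lemma lam2_smooth:
  assumes x: "x \<in> U" and c: "c \<in> charts_at M x"
  shows "smooth_fn_at c x lam2"
proof (rule smooth_fn_at_cong[OF x U _ c])
  show "smooth_fn_at c x (\<lambda>y. \<Sum>i\<in>UNIV. \<beta> i y * (\<Sum>j\<in>UNIV. a i j y * \<beta> j y))"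
    by (intro smooth_fn_at_sum smooth_fn_at_algebra a_smooth \<beta>_smooth x c)
  fix y assume y: "y \<in> U"
  have "b y \<bullet> (A y *v b y) = lam2 y" by (simp add: A_b[OF y] b_unit[OF y])
  then show "(\<Sum>i\<in>UNIV. \<beta> i y * (\<Sum>j\<in>UNIV. a i j y * \<beta> j y)) = lam2 y"
    by (simp add: inner_vec_def matrix_vector_mult_def A_def b_def)
qed

section \<open>Tangent planes of the leaves\<close>

lemma F_charts: "c \<in> F \<Longrightarrow> x \<in> fst c \<Longrightarrow> c \<in> charts_at M x" "c \<in> F \<Longrightarrow> x \<in> fst c \<Longrightarrow> x \<in> U"
  using foliated unfolding foliated_atlas_def charts_at_def by blast+

lemma F_cover: "x \<in> U \<Longrightarrow> \<exists>c. c \<in> F \<and> x \<in> fst c"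
  using foliated unfolding foliated_atlas_def by blast

text \<open>Membership in the leaf tangent space is a condition in all foliated charts around the
  point; the local agreement of plaques reduces it to the single chart \<open>c\<close>.\<close>

lemma leaf_tangent_vec_of:
  assumes c: "c \<in> F" "x \<in> fst c" and s: "conormal c x \<bullet> s = 0"
  shows "vec_of x s \<in> leaf_tangent_space M F x"
proof -
  have "vec_of x s c $ 3 = 0" using s by (simp add: conormal_vec_of)
  then show ?thesis
    unfolding leaf_tangent_space_def
    using foliated_charts_conormal[OF manifold foliated c] vec_of_tangent[OF F_charts(2)[OF c]] by blast
qed

text \<open>The factor \<open>r\<close> is the conformal factor at \<open>x\<close> of the leaf
  through \<open>x\<close>; the pulled back metric is expressed by \<open>S\<close>, and
  \<open>coords\<close> turns the statement into one about the matrix \<open>A x\<close>, as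
  \<open>conformal_plane\<close> requires.\<close>

lemma leaf_conformal:
  assumes x: "x \<in> U"
  obtains r where "\<And>c s t. c \<in> F \<Longrightarrow> x \<in> fst c \<Longrightarrow> conormal c x \<bullet> s = 0 \<Longrightarrow> conormal c x \<bullet> t = 0 \<Longrightarrow>
    s \<bullet> (A x *v t) = r * (s \<bullet> t)"
proof -
  define L where "L = {y. (x, y) \<in> (same_plaque F)\<^sup>*}"
  have "L \<in> leaves U F" using x by (auto simp: leaves_def L_def)
  then obtain \<rho> where "\<forall>x\<in>L. \<rho> x > 0 \<and>
     (\<forall>v\<in>leaf_tangent_space M F x. \<forall>w\<in>leaf_tangent_space M F x.
        metric N (\<phi> x) (push x v) (push x w) = \<rho> x * metric M x v w)"
    using conformal unfolding conformal_on_leaf_def by blast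
  moreover have "x \<in> L" by (simp add: L_def)
  ultimately have \<rho>: "metric N (\<phi> x) (push x v) (push x w) = \<rho> x * metric M x v w"
    if "v \<in> leaf_tangent_space M F x" "w \<in> leaf_tangent_space M F x" for v w
    using that by blast
  show thesis
  proof (rule that[of "\<rho> x"])
    fix c s t assume c: "c \<in> F" "x \<in> fst c" and st: "conormal c x \<bullet> s = 0" "conormal c x \<bullet> t = 0"
    have "metric M x (S x (vec_of x s)) (vec_of x t) = \<rho> x * metric M x (vec_of x s) (vec_of x t)"
      using \<rho>[OF leaf_tangent_vec_of[OF c st(1)] leaf_tangent_vec_of[OF c st(2)]]
      by (simp add: S_metric x vec_of_tangent)
    then show "s \<bullet> (A x *v t) = \<rho> x * (s \<bullet> t)"
      by (simp add: metric_coords x vec_of_tangent S_tangent coords_S coords_vec_of A_sym)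
  qed
qed

section \<open>The function \<open>mu\<close>\<close>

definition chart_mu :: "('a, 3) chart \<Rightarrow> 'a \<Rightarrow> real" where
  "chart_mu c x = b x \<bullet> cross3 (A x *v conormal c x) (conormal c x) / (conormal c x \<bullet> conormal c x)"

text \<open>The chosen chart may change erratically with the point. By \<open>mu_eq\<close> the
  value does not depend on it, so that near each point one fixed chart can be used.\<close>

definition mu :: "'a \<Rightarrow> real" where
  "mu x = chart_mu (SOME c. c \<in> F \<and> x \<in> fst c) x"

text \<open>The part \<open>s\<close> of the second conormal orthogonal to the first is tangent to
  the plaque of \<open>c\<close>, hence to that of \<open>d\<close>. It is then orthogonal to both
  conormals and so to itself.\<close>

lemma conormal_proportional:
  assumes c: "c \<in> F" "x \<in> fst c" and d: "d \<in> F" "x \<in> fst d"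
  obtains k where "k \<noteq> 0" "conormal d x = k *\<^sub>R conormal c x"
proof -
  let ?n = "conormal c x" and ?m = "conormal d x"
  define k where "k = (?n \<bullet> ?m) / (?n \<bullet> ?n)"
  define s where "s = ?m - k *\<^sub>R ?n"
  have n: "?n \<noteq> 0" "?m \<noteq> 0" using conormal_nonzero F_charts c d by blast+
  have ns: "?n \<bullet> s = 0" using n by (simp add: s_def k_def inner_diff_right)
  have "?m \<bullet> s = 0"
    using leaf_tangent_vec_of[OF c ns] d by (simp add: leaf_tangent_space_def conormal_vec_of)
  then have "s \<bullet> s = 0" using ns by (simp add: s_def inner_diff_left)
  then have "?m = k *\<^sub>R ?n" by (simp add: s_def)
  with n that show thesis by (metis scaleR_zero_left)
qed

lemma mu_eq:
  assumes "c \<in> F" "x \<in> fst c"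
  shows "mu x = chart_mu c x"
proof -
  define d where "d = (SOME c. c \<in> F \<and> x \<in> fst c)"
  have "d \<in> F \<and> x \<in> fst d" unfolding d_def by (rule someI[of _ c]) (simp add: assms)
  then obtain k where k: "k \<noteq> 0" "conormal d x = k *\<^sub>R conormal c x"
    using conormal_proportional[OF assms] by blast
  have "chart_mu d x = chart_mu c x"
    using k(1) by (simp add: chart_mu_def k(2) cross_mult_left cross_mult_right matrix_vector_mult_scaleR)
  then show ?thesis by (simp add: mu_def d_def)
qed

lemma
  assumes c: "c \<in> F" "x \<in> fst c"
  shows mu_square: "(mu x)\<^sup>2 = (lam2 x - lam1 x) * (lam3 x - lam2 x)"
    and mu_rank_one: "\<exists>m. \<forall>s. A x *v s - lam2 x *\<^sub>R s + mu x *\<^sub>R cross3 s (b x) = (conormal c x \<bullet> s) *\<^sub>R m"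
proof -
  have x: "x \<in> U" and ch: "c \<in> charts_at M x" using F_charts c by blast+
  obtain r where r: "\<And>s t. conormal c x \<bullet> s = 0 \<Longrightarrow> conormal c x \<bullet> t = 0 \<Longrightarrow>
      s \<bullet> (A x *v t) = r * (s \<bullet> t)"
    using leaf_conformal[OF x] c by metis
  note * = conformal_plane[OF matrix_vector_mul_linear A_sym[OF x] conormal_nonzero[OF x ch] r
      A_spectrum[OF x] _ _ b_unit[OF x] A_b[OF x]]
  show "(mu x)\<^sup>2 = (lam2 x - lam1 x) * (lam3 x - lam2 x)"
    by (rule *(1)) (use spectrum[OF x] mu_eq[OF c] in \<open>simp_all add: chart_mu_def\<close>)
  show "\<exists>m. \<forall>s. A x *v s - lam2 x *\<^sub>R s + mu x *\<^sub>R cross3 s (b x) = (conormal c x \<bullet> s) *\<^sub>R m"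
    by (rule *(2)) (use spectrum[OF x] mu_eq[OF c] in \<open>simp_all add: chart_mu_def\<close>)
qed

lemma mu_cases:
  assumes "x \<in> U"
  shows "mu x = sqrt (lam2 x - lam1 x) * sqrt (lam3 x - lam2 x) \<or>
    mu x = - (sqrt (lam2 x - lam1 x) * sqrt (lam3 x - lam2 x))"
proof -
  obtain c where "c \<in> F" "x \<in> fst c" using F_cover[OF assms] by blast
  moreover have "(sqrt (lam2 x - lam1 x) * sqrt (lam3 x - lam2 x))\<^sup>2 = (lam2 x - lam1 x) * (lam3 x - lam2 x)"
    using spectrum[OF assms] by (simp add: power_mult_distrib)
  ultimately show ?thesis using mu_square by (metis power2_eq_iff)
qed

lemma mu_smooth:
  assumes "c \<in> F" "x \<in> fst c"
  shows "smooth_fn_at c x mu"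
proof (rule smooth_fn_at_cong[OF assms(2)])
  have x: "x \<in> U" and c: "c \<in> charts_at M x" using F_charts assms by blast+
  show "openin (mtop M) (fst c)" using chart_openin[OF manifold, of c] c by (simp add: charts_at_def)
  show "c \<in> charts_at M x" by fact
  \<comment> \<open>Written out in components, the formula is a quotient of polynomials in functions
    already known to be smooth, with the squared length of the conormal as denominator.\<close>
  have "chart_mu c = (\<lambda>y. (\<beta> 1 y * ((\<Sum>j\<in>UNIV. a 2 j y * conormal c y $ j) * conormal c y $ 3
        - (\<Sum>j\<in>UNIV. a 3 j y * conormal c y $ j) * conormal c y $ 2)
      + \<beta> 2 y * ((\<Sum>j\<in>UNIV. a 3 j y * conormal c y $ j) * conormal c y $ 1
        - (\<Sum>j\<in>UNIV. a 1 j y * conormal c y $ j) * conormal c y $ 3)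
      + \<beta> 3 y * ((\<Sum>j\<in>UNIV. a 1 j y * conormal c y $ j) * conormal c y $ 2
        - (\<Sum>j\<in>UNIV. a 2 j y * conormal c y $ j) * conormal c y $ 1))
      / (\<Sum>j\<in>UNIV. conormal c y $ j * conormal c y $ j))"
    unfolding chart_mu_def[abs_def]
    by (simp add: inner_vec_def sum_3 cross_components b_def A_def matrix_vector_mult_def fun_eq_iff mult.commute)
  moreover have "(\<Sum>j\<in>UNIV. conormal c x $ j * conormal c x $ j) \<noteq> 0"
  proof -
    have "(\<Sum>j\<in>UNIV. conormal c x $ j * conormal c x $ j) = conormal c x \<bullet> conormal c x"
      by (simp add: inner_vec_def)
    then show ?thesis using conormal_nonzero[OF x c] by simp
  qed
  ultimately show "smooth_fn_at c x (chart_mu c)"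
    by (simp only:) (intro smooth_fn_at_divide smooth_fn_at_sum smooth_fn_at_algebra a_smooth \<beta>_smooth
        conormal_smooth x c)
  show "chart_mu c y = mu y" if "y \<in> fst c" for y using mu_eq[OF assms(1) that] by simp
qed

text \<open>These are the rows of the matrix of \<open>s \<mapsto> A s - lam2 s + mu (s \<times> b)\<close>.\<close>

lemma mu_rows:
  assumes c: "c \<in> F" "x \<in> fst c"
  defines "n \<equiv> \<lambda>j. conormal c x $ j"
  shows "\<exists>m. a 1 1 x - lam2 x = m * n 1 \<and> a 1 2 x + mu x * \<beta> 3 x = m * n 2 \<and> a 1 3 x - mu x * \<beta> 2 x = m * n 3"
    and "\<exists>m. a 1 2 x - mu x * \<beta> 3 x = m * n 1 \<and> a 2 2 x - lam2 x = m * n 2 \<and> a 2 3 x + mu x * \<beta> 1 x = m * n 3"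
    and "\<exists>m. a 1 3 x + mu x * \<beta> 2 x = m * n 1 \<and> a 2 3 x - mu x * \<beta> 1 x = m * n 2 \<and> a 3 3 x - lam2 x = m * n 3"
proof -
  have x: "x \<in> U" using F_charts c by blast
  obtain m where m: "\<And>s. A x *v s - lam2 x *\<^sub>R s + mu x *\<^sub>R cross3 s (b x) = (conormal c x \<bullet> s) *\<^sub>R m"
    using mu_rank_one[OF c] by blast
  have sym: "a 2 1 x = a 1 2 x" "a 3 1 x = a 1 3 x" "a 3 2 x = a 2 3 x" using a_sym[OF x] by auto
  \<comment> \<open>Evaluation at the j-th basis vector shows that column j is the j-th conormal
    coefficient times \<open>m\<close>. Read by rows, row i is \<open>m $ i\<close> times the
    conormal.\<close>
  have "(A x *v s - lam2 x *\<^sub>R s + mu x *\<^sub>R cross3 s (b x)) $ i = (conormal c x \<bullet> s) * m $ i" for s i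
    by (simp add: m)
  note E = this[of "axis 1 1"] this[of "axis 2 1"] this[of "axis 3 1"]
  note E' = E[of 1] E[of 2] E[of 3]
  have *: "a 1 1 x - lam2 x = m $ 1 * n 1" "a 1 2 x + mu x * \<beta> 3 x = m $ 1 * n 2" "a 1 3 x - mu x * \<beta> 2 x = m $ 1 * n 3"
    "a 1 2 x - mu x * \<beta> 3 x = m $ 2 * n 1" "a 2 2 x - lam2 x = m $ 2 * n 2" "a 2 3 x + mu x * \<beta> 1 x = m $ 2 * n 3"
    "a 1 3 x + mu x * \<beta> 2 x = m $ 3 * n 1" "a 2 3 x - mu x * \<beta> 1 x = m $ 3 * n 2" "a 3 3 x - lam2 x = m $ 3 * n 3"
    using E' by (simp_all add: n_def matrix_vector_mult_def sum_3 A_def b_def cross_components axis_def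
        inner_vec_def sym mult.commute)
  show "\<exists>m. a 1 1 x - lam2 x = m * n 1 \<and> a 1 2 x + mu x * \<beta> 3 x = m * n 2 \<and> a 1 3 x - mu x * \<beta> 2 x = m * n 3"
    and "\<exists>m. a 1 2 x - mu x * \<beta> 3 x = m * n 1 \<and> a 2 2 x - lam2 x = m * n 2 \<and> a 2 3 x + mu x * \<beta> 1 x = m * n 3"
    and "\<exists>m. a 1 3 x + mu x * \<beta> 2 x = m * n 1 \<and> a 2 3 x - mu x * \<beta> 1 x = m * n 2 \<and> a 3 3 x - lam2 x = m * n 3"
    using * by blast+
qed

text \<open>The three identities are the Frobenius conditions for the third, the second and the
  first row, in this order. Everything is fixed at one point \<open>x\<close>: \<open>C\<close>,
  \<open>da\<close>, \<open>d\<beta>\<close>, \<open>\<gamma>\<close> and \<open>d\<mu>\<close> are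
  values there, and only the rows themselves are needed as functions nearby.\<close>

lemma integrability:
  assumes x: "x \<in> U"
    and br: "\<And>j k. lie_bracket M (e j) (e k) x = (\<lambda>c. \<Sum>i\<in>UNIV. C i j k *\<^sub>R e i x c)"
    and da: "\<And>i j k. differential M (a i j) x (e k x) = da i j k"
    and d\<beta>: "\<And>i k. differential M (\<beta> i) x (e k x) = d\<beta> i k"
    and \<gamma>: "\<And>k. differential M lam2 x (e k x) = \<gamma> k"
    and d\<mu>: "\<And>k. differential M mu x (e k x) = d\<mu> k"
  shows "0 = (- da 1 3 2 + da 2 3 1 - \<beta> 1 x * d\<mu> 1 - \<beta> 2 x * d\<mu> 2 - mu x * d\<beta> 1 1 - mu x * d\<beta> 2 2
        - (a 1 3 x + mu x * \<beta> 2 x) * C 1 1 2 - (a 2 3 x - mu x * \<beta> 1 x) * C 2 1 2 - (a 3 3 x - lam2 x) * C 3 1 2) * (a 3 3 x - lam2 x)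
      - (- da 1 3 3 + da 3 3 1 - \<beta> 2 x * d\<mu> 3 - mu x * d\<beta> 2 3 - \<gamma> 1
        - (a 1 3 x + mu x * \<beta> 2 x) * C 1 1 3 - (a 2 3 x - mu x * \<beta> 1 x) * C 2 1 3 - (a 3 3 x - lam2 x) * C 3 1 3) * (a 2 3 x - mu x * \<beta> 1 x)
      + (- da 2 3 3 + da 3 3 2 + \<beta> 1 x * d\<mu> 3 + mu x * d\<beta> 1 3 - \<gamma> 2
        - (a 1 3 x + mu x * \<beta> 2 x) * C 1 2 3 - (a 2 3 x - mu x * \<beta> 1 x) * C 2 2 3 - (a 3 3 x - lam2 x) * C 3 2 3) * (a 1 3 x + mu x * \<beta> 2 x)"
    and "0 = (- da 1 2 2 + da 2 2 1 + \<beta> 3 x * d\<mu> 2 + mu x * d\<beta> 3 2 - \<gamma> 1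
        - (a 1 2 x - mu x * \<beta> 3 x) * C 1 1 2 - (a 2 2 x - lam2 x) * C 2 1 2 - (a 2 3 x + mu x * \<beta> 1 x) * C 3 1 2) * (a 2 3 x + mu x * \<beta> 1 x)
      - (- da 1 2 3 + da 2 3 1 + \<beta> 3 x * d\<mu> 3 + \<beta> 1 x * d\<mu> 1 + mu x * d\<beta> 3 3 + mu x * d\<beta> 1 1
        - (a 1 2 x - mu x * \<beta> 3 x) * C 1 1 3 - (a 2 2 x - lam2 x) * C 2 1 3 - (a 2 3 x + mu x * \<beta> 1 x) * C 3 1 3) * (a 2 2 x - lam2 x)
      + (- da 2 2 3 + da 2 3 2 + \<beta> 1 x * d\<mu> 2 + mu x * d\<beta> 1 2 + \<gamma> 3
        - (a 1 2 x - mu x * \<beta> 3 x) * C 1 2 3 - (a 2 2 x - lam2 x) * C 2 2 3 - (a 2 3 x + mu x * \<beta> 1 x) * C 3 2 3) * (a 1 2 x - mu x * \<beta> 3 x)"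
    and "0 = (- da 1 1 2 + da 1 2 1 + \<beta> 3 x * d\<mu> 1 + mu x * d\<beta> 3 1 + \<gamma> 2
        - (a 1 1 x - lam2 x) * C 1 1 2 - (a 1 2 x + mu x * \<beta> 3 x) * C 2 1 2 - (a 1 3 x - mu x * \<beta> 2 x) * C 3 1 2) * (a 1 3 x - mu x * \<beta> 2 x)
      - (- da 1 1 3 + da 1 3 1 - \<beta> 2 x * d\<mu> 1 - mu x * d\<beta> 2 1 + \<gamma> 3
        - (a 1 1 x - lam2 x) * C 1 1 3 - (a 1 2 x + mu x * \<beta> 3 x) * C 2 1 3 - (a 1 3 x - mu x * \<beta> 2 x) * C 3 1 3) * (a 1 2 x + mu x * \<beta> 3 x)
      + (- da 1 2 3 + da 1 3 2 - \<beta> 2 x * d\<mu> 2 - \<beta> 3 x * d\<mu> 3 - mu x * d\<beta> 2 2 - mu x * d\<beta> 3 3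
        - (a 1 1 x - lam2 x) * C 1 2 3 - (a 1 2 x + mu x * \<beta> 3 x) * C 2 2 3 - (a 1 3 x - mu x * \<beta> 2 x) * C 3 2 3) * (a 1 1 x - lam2 x)"
proof -
  obtain c where cF: "c \<in> F" "x \<in> fst c" using F_cover[OF x] by blast
  then have c: "c \<in> charts_at M x" by (rule F_charts)
  have W: "openin (mtop M) (fst c)" using chart_openin[OF manifold, of c] c by (simp add: charts_at_def)
  note sm = a_smooth[OF x c] \<beta>_smooth[OF x c] lam2_smooth[OF x c] mu_smooth[OF cF]
  have D: "frame_deriv c x (a i j) k = da i j k" "frame_deriv c x (\<beta> i) k = d\<beta> i k"
    "frame_deriv c x lam2 k = \<gamma> k" "frame_deriv c x mu k = d\<mu> k" for i j k
    using da d\<beta> \<gamma> d\<mu> by (simp_all add: differential_frame[OF _ c x] sm)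
  note mb = smooth_fn_at_algebra(3)[OF mu_smooth[OF cF] \<beta>_smooth[OF x c]]
  \<comment> \<open>Every entry of a row has one of these three shapes; the product rule for
    \<open>mu\<close> times \<open>\<beta>\<close> is what brings \<open>d\<mu>\<close> and
    \<open>d\<beta>\<close> into the identities.\<close>
  have G: "smooth_fn_at c x (\<lambda>y. a i j y + mu y * \<beta> k y)" "smooth_fn_at c x (\<lambda>y. a i j y - mu y * \<beta> k y)"
    "smooth_fn_at c x (\<lambda>y. a i j y - lam2 y)"
    "frame_deriv c x (\<lambda>y. a i j y + mu y * \<beta> k y) l = da i j l + (mu x * d\<beta> k l + d\<mu> l * \<beta> k x)"
    "frame_deriv c x (\<lambda>y. a i j y - mu y * \<beta> k y) l = da i j l - (mu x * d\<beta> k l + d\<mu> l * \<beta> k x)"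
    "frame_deriv c x (\<lambda>y. a i j y - lam2 y) l = da i j l - \<gamma> l" for i j k l
    using sm mb by (simp_all add: smooth_fn_at_algebra frame_deriv_algebra[OF _ _ c] D)
  show "0 = (- da 1 3 2 + da 2 3 1 - \<beta> 1 x * d\<mu> 1 - \<beta> 2 x * d\<mu> 2 - mu x * d\<beta> 1 1 - mu x * d\<beta> 2 2
        - (a 1 3 x + mu x * \<beta> 2 x) * C 1 1 2 - (a 2 3 x - mu x * \<beta> 1 x) * C 2 1 2 - (a 3 3 x - lam2 x) * C 3 1 2) * (a 3 3 x - lam2 x)
      - (- da 1 3 3 + da 3 3 1 - \<beta> 2 x * d\<mu> 3 - mu x * d\<beta> 2 3 - \<gamma> 1
        - (a 1 3 x + mu x * \<beta> 2 x) * C 1 1 3 - (a 2 3 x - mu x * \<beta> 1 x) * C 2 1 3 - (a 3 3 x - lam2 x) * C 3 1 3) * (a 2 3 x - mu x * \<beta> 1 x)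
      + (- da 2 3 3 + da 3 3 2 + \<beta> 1 x * d\<mu> 3 + mu x * d\<beta> 1 3 - \<gamma> 2
        - (a 1 3 x + mu x * \<beta> 2 x) * C 1 2 3 - (a 2 3 x - mu x * \<beta> 1 x) * C 2 2 3 - (a 3 3 x - lam2 x) * C 3 2 3) * (a 1 3 x + mu x * \<beta> 2 x)"
    by (rule frobenius3[where W = "fst c" and p = "\<lambda>y. a 1 3 y + mu y * \<beta> 2 y" and q = "\<lambda>y. a 2 3 y - mu y * \<beta> 1 y"
          and r = "\<lambda>y. a 3 3 y - lam2 y",
          OF x c cF(2) W _ _ _ mu_rows(3)[OF cF(1)] br])
      (simp_all only: G, simp_all add: algebra_simps)
  show "0 = (- da 1 2 2 + da 2 2 1 + \<beta> 3 x * d\<mu> 2 + mu x * d\<beta> 3 2 - \<gamma> 1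
        - (a 1 2 x - mu x * \<beta> 3 x) * C 1 1 2 - (a 2 2 x - lam2 x) * C 2 1 2 - (a 2 3 x + mu x * \<beta> 1 x) * C 3 1 2) * (a 2 3 x + mu x * \<beta> 1 x)
      - (- da 1 2 3 + da 2 3 1 + \<beta> 3 x * d\<mu> 3 + \<beta> 1 x * d\<mu> 1 + mu x * d\<beta> 3 3 + mu x * d\<beta> 1 1
        - (a 1 2 x - mu x * \<beta> 3 x) * C 1 1 3 - (a 2 2 x - lam2 x) * C 2 1 3 - (a 2 3 x + mu x * \<beta> 1 x) * C 3 1 3) * (a 2 2 x - lam2 x)
      + (- da 2 2 3 + da 2 3 2 + \<beta> 1 x * d\<mu> 2 + mu x * d\<beta> 1 2 + \<gamma> 3
        - (a 1 2 x - mu x * \<beta> 3 x) * C 1 2 3 - (a 2 2 x - lam2 x) * C 2 2 3 - (a 2 3 x + mu x * \<beta> 1 x) * C 3 2 3) * (a 1 2 x - mu x * \<beta> 3 x)"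
    by (rule frobenius3[where W = "fst c" and p = "\<lambda>y. a 1 2 y - mu y * \<beta> 3 y" and q = "\<lambda>y. a 2 2 y - lam2 y"
          and r = "\<lambda>y. a 2 3 y + mu y * \<beta> 1 y",
          OF x c cF(2) W _ _ _ mu_rows(2)[OF cF(1)] br])
      (simp_all only: G, simp_all add: algebra_simps)
  show "0 = (- da 1 1 2 + da 1 2 1 + \<beta> 3 x * d\<mu> 1 + mu x * d\<beta> 3 1 + \<gamma> 2
        - (a 1 1 x - lam2 x) * C 1 1 2 - (a 1 2 x + mu x * \<beta> 3 x) * C 2 1 2 - (a 1 3 x - mu x * \<beta> 2 x) * C 3 1 2) * (a 1 3 x - mu x * \<beta> 2 x)
      - (- da 1 1 3 + da 1 3 1 - \<beta> 2 x * d\<mu> 1 - mu x * d\<beta> 2 1 + \<gamma> 3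
        - (a 1 1 x - lam2 x) * C 1 1 3 - (a 1 2 x + mu x * \<beta> 3 x) * C 2 1 3 - (a 1 3 x - mu x * \<beta> 2 x) * C 3 1 3) * (a 1 2 x + mu x * \<beta> 3 x)
      + (- da 1 2 3 + da 1 3 2 - \<beta> 2 x * d\<mu> 2 - \<beta> 3 x * d\<mu> 3 - mu x * d\<beta> 2 2 - mu x * d\<beta> 3 3
        - (a 1 1 x - lam2 x) * C 1 2 3 - (a 1 2 x + mu x * \<beta> 3 x) * C 2 2 3 - (a 1 3 x - mu x * \<beta> 2 x) * C 3 2 3) * (a 1 1 x - lam2 x)"
    by (rule frobenius3[where W = "fst c" and p = "\<lambda>y. a 1 1 y - lam2 y" and q = "\<lambda>y. a 1 2 y + mu y * \<beta> 3 y"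
          and r = "\<lambda>y. a 1 3 y - mu y * \<beta> 2 y",
          OF x c cF(2) W _ _ _ mu_rows(1)[OF cF(1)] br])
      (simp_all only: G, simp_all add: algebra_simps)
qed

end

theorem theorem4p2:
  fixes M :: "('a, 3) oriented_riemannian" and N :: "('b, 3) oriented_riemannian"
    and \<phi> :: "'a \<Rightarrow> 'b" and U :: "'a set"
    and lam1 lam2 lam3 :: "'a \<Rightarrow> real"
    and \<xi>2 :: "('a, 3) vfield" and \<eta>2 :: "'a \<Rightarrow> ('a, 3) tangent \<Rightarrow> real"
    and e :: "3 \<Rightarrow> ('a, 3) vfield" and \<omega> :: "3 \<Rightarrow> 'a \<Rightarrow> ('a, 3) tangent \<Rightarrow> real"
    and a :: "3 \<Rightarrow> 3 \<Rightarrow> 'a \<Rightarrow> real" and da :: "3 \<Rightarrow> 3 \<Rightarrow> 3 \<Rightarrow> 'a \<Rightarrow> real"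
    and \<beta> :: "3 \<Rightarrow> 'a \<Rightarrow> real" and d\<beta> :: "3 \<Rightarrow> 3 \<Rightarrow> 'a \<Rightarrow> real"
    and \<gamma> :: "3 \<Rightarrow> 'a \<Rightarrow> real" and C :: "3 \<Rightarrow> 3 \<Rightarrow> 3 \<Rightarrow> 'a \<Rightarrow> real"
  assumes "oriented_riemannian_manifold M" and "oriented_riemannian_manifold N"
    and "diffeomorphism M N \<phi>"
    and "\<And>x. x \<in> mpoints M \<Longrightarrow> lam1 x < lam2 x \<and> lam2 x < lam3 x \<and>
           eigenvalues_at M x (S_endo M N \<phi> x) = {lam1 x, lam2 x, lam3 x}"
    and "openin (mtop M) U"
    and "smooth_vfield_on M U \<xi>2"
    and "\<And>x. x \<in> U \<Longrightarrow> metric M x (\<xi>2 x) (\<xi>2 x) = 1 \<and>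
           eigenvector_at M x (S_endo M N \<phi> x) (lam2 x) (\<xi>2 x)"
    and "\<And>x v. x \<in> U \<Longrightarrow> v \<in> tangent_space M x \<Longrightarrow> \<eta>2 x v = metric M x (\<xi>2 x) v"
    and "pos_orthonormal_frame_on M U e" and "dual_coframe_on M U e \<omega>"
    and "\<And>i x v. x \<in> U \<Longrightarrow> v \<in> tangent_space M x \<Longrightarrow>
           \<omega> i x (S_endo M N \<phi> x v) = (\<Sum>j\<in>UNIV. a i j x * \<omega> j x v)"
    and "\<And>x v. x \<in> U \<Longrightarrow> v \<in> tangent_space M x \<Longrightarrow>
           \<eta>2 x v = (\<Sum>i\<in>UNIV. \<beta> i x * \<omega> i x v)"
    and "\<And>i j x v. x \<in> U \<Longrightarrow> v \<in> tangent_space M x \<Longrightarrow>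
           differential M (a i j) x v = (\<Sum>k\<in>UNIV. da i j k x * \<omega> k x v)"
    and "\<And>i x v. x \<in> U \<Longrightarrow> v \<in> tangent_space M x \<Longrightarrow>
           differential M (\<beta> i) x v = (\<Sum>k\<in>UNIV. d\<beta> i k x * \<omega> k x v)"
    and "\<And>x v. x \<in> U \<Longrightarrow> v \<in> tangent_space M x \<Longrightarrow>
           differential M lam2 x v = (\<Sum>k\<in>UNIV. \<gamma> k x * \<omega> k x v)"
    and "\<And>j k x. x \<in> U \<Longrightarrow>
           lie_bracket M (e j) (e k) x = (\<lambda>c. \<Sum>i\<in>UNIV. C i j k x *\<^sub>R e i x c)"
    and "leafwise_conformal M N \<phi> U"
  shows "\<exists>(\<mu> :: 'a \<Rightarrow> real) (d\<mu> :: 3 \<Rightarrow> 'a \<Rightarrow> real).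
       smooth_fun_on M U \<mu> \<and>
       (\<forall>x\<in>U. \<mu> x = sqrt (lam2 x - lam1 x) * sqrt (lam3 x - lam2 x) \<or>
               \<mu> x = - (sqrt (lam2 x - lam1 x) * sqrt (lam3 x - lam2 x))) \<and>
       (\<forall>x\<in>U. \<forall>v\<in>tangent_space M x. differential M \<mu> x v = (\<Sum>k\<in>UNIV. d\<mu> k x * \<omega> k x v)) \<and>
       (\<forall>x\<in>{x \<in> U. (a 2 3 x - \<mu> x * \<beta> 1 x)\<^sup>2 + (a 1 3 x + \<mu> x * \<beta> 2 x)\<^sup>2 > 0}. 0 =
           (- da 1 3 2 x + da 2 3 1 x - \<beta> 1 x * d\<mu> 1 x - \<beta> 2 x * d\<mu> 2 x - \<mu> x * d\<beta> 1 1 x - \<mu> x * d\<beta> 2 2 x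
              - (a 1 3 x + \<mu> x * \<beta> 2 x) * C 1 1 2 x - (a 2 3 x - \<mu> x * \<beta> 1 x) * C 2 1 2 x - (a 3 3 x - lam2 x) * C 3 1 2 x) * (a 3 3 x - lam2 x)
           - (- da 1 3 3 x + da 3 3 1 x - \<beta> 2 x * d\<mu> 3 x - \<mu> x * d\<beta> 2 3 x - \<gamma> 1 x
              - (a 1 3 x + \<mu> x * \<beta> 2 x) * C 1 1 3 x - (a 2 3 x - \<mu> x * \<beta> 1 x) * C 2 1 3 x - (a 3 3 x - lam2 x) * C 3 1 3 x) * (a 2 3 x - \<mu> x * \<beta> 1 x)
           + (- da 2 3 3 x + da 3 3 2 x + \<beta> 1 x * d\<mu> 3 x + \<mu> x * d\<beta> 1 3 x - \<gamma> 2 x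
              - (a 1 3 x + \<mu> x * \<beta> 2 x) * C 1 2 3 x - (a 2 3 x - \<mu> x * \<beta> 1 x) * C 2 2 3 x - (a 3 3 x - lam2 x) * C 3 2 3 x) * (a 1 3 x + \<mu> x * \<beta> 2 x)) \<and>
       (\<forall>x\<in>{x \<in> U. (a 2 3 x + \<mu> x * \<beta> 1 x)\<^sup>2 + (a 1 2 x - \<mu> x * \<beta> 3 x)\<^sup>2 > 0}. 0 =
           (- da 1 2 2 x + da 2 2 1 x + \<beta> 3 x * d\<mu> 2 x + \<mu> x * d\<beta> 3 2 x - \<gamma> 1 x
              - (a 1 2 x - \<mu> x * \<beta> 3 x) * C 1 1 2 x - (a 2 2 x - lam2 x) * C 2 1 2 x - (a 2 3 x + \<mu> x * \<beta> 1 x) * C 3 1 2 x) * (a 2 3 x + \<mu> x * \<beta> 1 x)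
           - (- da 1 2 3 x + da 2 3 1 x + \<beta> 3 x * d\<mu> 3 x + \<beta> 1 x * d\<mu> 1 x + \<mu> x * d\<beta> 3 3 x + \<mu> x * d\<beta> 1 1 x
              - (a 1 2 x - \<mu> x * \<beta> 3 x) * C 1 1 3 x - (a 2 2 x - lam2 x) * C 2 1 3 x - (a 2 3 x + \<mu> x * \<beta> 1 x) * C 3 1 3 x) * (a 2 2 x - lam2 x)
           + (- da 2 2 3 x + da 2 3 2 x + \<beta> 1 x * d\<mu> 2 x + \<mu> x * d\<beta> 1 2 x + \<gamma> 3 x
              - (a 1 2 x - \<mu> x * \<beta> 3 x) * C 1 2 3 x - (a 2 2 x - lam2 x) * C 2 2 3 x - (a 2 3 x + \<mu> x * \<beta> 1 x) * C 3 2 3 x) * (a 1 2 x - \<mu> x * \<beta> 3 x)) \<and>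
       (\<forall>x\<in>{x \<in> U. (a 1 2 x + \<mu> x * \<beta> 3 x)\<^sup>2 + (a 1 3 x - \<mu> x * \<beta> 2 x)\<^sup>2 > 0}. 0 =
           (- da 1 1 2 x + da 1 2 1 x + \<beta> 3 x * d\<mu> 1 x + \<mu> x * d\<beta> 3 1 x + \<gamma> 2 x
              - (a 1 1 x - lam2 x) * C 1 1 2 x - (a 1 2 x + \<mu> x * \<beta> 3 x) * C 2 1 2 x - (a 1 3 x - \<mu> x * \<beta> 2 x) * C 3 1 2 x) * (a 1 3 x - \<mu> x * \<beta> 2 x)
           - (- da 1 1 3 x + da 1 3 1 x - \<beta> 2 x * d\<mu> 1 x - \<mu> x * d\<beta> 2 1 x + \<gamma> 3 x
              - (a 1 1 x - lam2 x) * C 1 1 3 x - (a 1 2 x + \<mu> x * \<beta> 3 x) * C 2 1 3 x - (a 1 3 x - \<mu> x * \<beta> 2 x) * C 3 1 3 x) * (a 1 2 x + \<mu> x * \<beta> 3 x)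
           + (- da 1 2 3 x + da 1 3 2 x - \<beta> 2 x * d\<mu> 2 x - \<beta> 3 x * d\<mu> 3 x - \<mu> x * d\<beta> 2 2 x - \<mu> x * d\<beta> 3 3 x
              - (a 1 1 x - lam2 x) * C 1 2 3 x - (a 1 2 x + \<mu> x * \<beta> 3 x) * C 2 2 3 x - (a 1 3 x - \<mu> x * \<beta> 2 x) * C 3 2 3 x) * (a 1 1 x - lam2 x))"
proof -
  obtain F where F: "foliated_atlas M U F" "\<And>L. L \<in> leaves U F \<Longrightarrow> conformal_on_leaf M N \<phi> F L"
    using assms(17) unfolding leafwise_conformal_def by blast
  interpret conformal_foliation M U e \<omega> N \<phi> lam1 lam2 lam3 \<xi>2 a \<beta> F
  proof
    show "lam1 x < lam2 x \<and> lam2 x < lam3 x \<and>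
        eigenvalues_at M x (S_endo M N \<phi> x) = {lam1 x, lam2 x, lam3 x}" if "x \<in> U" for x
      using that assms(4)[of x] openin_subset[OF assms(5)] by blast
    show "metric M x (\<xi>2 x) v = (\<Sum>i\<in>UNIV. \<beta> i x * \<omega> i x v)"
      if "x \<in> U" "v \<in> tangent_space M x" for x v
      using assms(8,12)[OF that] by simp
  qed (fact assms(1-3,5-7,9-11) F)+
  define d\<mu> where "d\<mu> k x = differential M mu x (e k x)" for k x
  \<comment> \<open>Evaluating an expansion in the coframe on \<open>e l\<close> isolates its l-th
    coefficient. Hence \<open>da\<close>, \<open>d\<beta>\<close> and \<open>\<gamma>\<close>, which
    are given through expansions, are derivatives along the frame.\<close>
  have pick: "t = u" if "x \<in> U" "t = (\<Sum>k\<in>UNIV. s k * \<omega> k x (e l x))" "u = s l" for s :: "3 \<Rightarrow> real" and t u x l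
    unfolding that(2,3) by (simp add: coframe_dual[OF that(1)] if_distrib[of "\<lambda>z. _ * z"] cong: if_cong)
  note I = integrability[where C = "\<lambda>i j k. C i j k x" and da = "\<lambda>i j k. da i j k x"
      and d\<beta> = "\<lambda>i k. d\<beta> i k x" and \<gamma> = "\<lambda>k. \<gamma> k x" and d\<mu> = "\<lambda>k. d\<mu> k x" for x,
      OF _ assms(16) pick[OF _ assms(13) refl] pick[OF _ assms(14) refl] pick[OF _ assms(15) refl]
        d\<mu>_def[symmetric], OF _ _ _ _ frame_tangent _ _ frame_tangent _ _ frame_tangent]
  show ?thesis
  proof (intro exI[of _ mu] exI[of _ d\<mu>] conjI)
    show "smooth_fun_on M U mu"
    proof (rule smooth_fun_onI[OF manifold])
      fix x assume "x \<in> U"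
      then obtain c where "c \<in> F" "x \<in> fst c" using F_cover by blast
      then show "\<exists>c\<in>charts_at M x. smooth_at (mu \<circ> cinv c) (snd c x)"
        using mu_smooth F_charts(1) unfolding smooth_fn_at_def comp_def by blast
    qed
    show "\<forall>x\<in>U. mu x = sqrt (lam2 x - lam1 x) * sqrt (lam3 x - lam2 x) \<or>
        mu x = - (sqrt (lam2 x - lam1 x) * sqrt (lam3 x - lam2 x))"
      using mu_cases by blast
    show "\<forall>x\<in>U. \<forall>v\<in>tangent_space M x. differential M mu x v = (\<Sum>k\<in>UNIV. d\<mu> k x * \<omega> k x v)"
    proof (intro ballI)
      fix x v assume x: "x \<in> U" and v: "v \<in> tangent_space M x"
      obtain c where "c \<in> F" "x \<in> fst c" using F_cover[OF x] by blast
      then show "differential M mu x v = (\<Sum>k\<in>UNIV. d\<mu> k x * \<omega> k x v)"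
        unfolding d\<mu>_def using differential_expand[OF mu_smooth F_charts(1) x v] by blast
    qed
  qed (intro ballI, elim CollectE conjE, (rule I(1) | rule I(2) | rule I(3)); assumption)+
qed

end
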